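(* Let $\Gamma$ be the vertex–edge graph of the regular triangular tiling of the hyperbolic plane in which seven triangles meet at every vertex, fix a vertex $O$, and let $L(v)$ be the graph distance from $v$ to $O$ in $\Gamma$. For $m\in\mathbb{N}$ let $\Gamma_m=\{v: L(v)\le m\}$. For every non-empty $P\subset\Gamma_m$, the toppling function of the state $\phi_m^P=6+\sum_{p\in P}\delta_p$ on $\Gamma_m$ satisfies, for all $v\in\Gamma_m$, $$\mathcal{T}_{\phi_m^P}(v)=\min\bigl(m+1-L(v),\,m+1-L(P)\bigr),$$ where $L(P)=\min_{p\in P}L(p)$.
   Context: Graph: Take a hyperbolic triangle $\Delta\subset\mathbb{H}^2$ with all three angles equal to $2\pi/7$; the group generated by reflections in its sides tiles $\mathbb{H}^2$ by copies of $\Delta$. $\Gamma$ is the graph whose vertices and edges are the images of the vertices and edges of $\Delta$; it is $7$-regular. $n(v)$ denotes the set of the $7$ neighbours of $v$ in $\Gamma$, and $\delta_v$ is the function equal to $1$ at $v$ and $0$ elsewhere. Sandpile on $\Gamma_m$: a state is a function $\phi:\Gamma_m\to\mathbb{Z}_{\ge0}$. The toppling at $v\in\Gamma_m$ is $T_v\phi(u)=\phi(u)+\Delta\delta_v(u)$, where $\Delta f(w)=-7f(w)+\sum_{u\in n(w)\cap\Gamma_m}f(u)$ (so toppling $v$ removes 7 grains from $v$ and adds one grain to each neighbour of $v$ lying in $\Gamma_m$; grains sent outside $\Gamma_m$ are lost). A toppling at $v$ is legal if $\phi(v)\ge7$; a state is stable if $\phi(v)<7$ for all $v$. A relaxation of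 $\psi_0$ is a sequence of legal topplings $\psi_0,\psi_1,\dots,\psi_N$ ending at a stable state; it always exists, its final state $\psi_0^\circ$ is independent of the choices, and so is the toppling function $\mathcal{T}_{\psi_0}(v)$ = the number of topplings performed at $v$ in a relaxation of $\psi_0$. The maximal stable state is $\phi_m\equiv6$ on $\Gamma_m$, and for non-empty $P\subset\Gamma_m$, $\phi_m^P=\phi_m+\sum_{v\in P}\delta_v$. *)

theory Defs
  imports Complex_Main
begin

text \<open>Hyperbolic plane = open unit disk in the complex plane.  The triangle Delta is the
equilateral hyperbolic triangle centred at 0 with all angles 2 pi/7.  Its circumradius R
satisfies cosh R = cot(pi/3) cot(pi/7) = cot(pi/7)/sqrt 3 (right triangle centre / vertex /
midpoint of a side), and a point at hyperbolic distance R from 0 has Euclidean modulus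
tanh(R/2) = sqrt((cosh R - 1)/(cosh R + 1)).\<close>

definition coshR :: real where
  "coshR = cot (pi / 7) / sqrt 3"

definition rho :: real where
  "rho = sqrt ((coshR - 1) / (coshR + 1))"

definition tri_vert :: "nat \<Rightarrow> complex" where
  "tri_vert i = complex_of_real rho * cis (2 * pi * real i / 3)"

definition mob :: "complex \<Rightarrow> complex \<Rightarrow> complex" where
  "mob p z = (z - p) / (1 - cnj p * z)"

definition mob_inv :: "complex \<Rightarrow> complex \<Rightarrow> complex" where
  "mob_inv p w = (w + p) / (1 + cnj p * w)"

text \<open>Hyperbolic reflection in the geodesic through p and q (p \<noteq> q in the disk):
conjugate by mob p the Euclidean reflection in the diameter through mob p q.\<close>
definition geo_refl :: "complex \<Rightarrow> complex \<Rightarrow> complex \<Rightarrow> complex" where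
  "geo_refl p q z = (let w = mob p q in mob_inv p (w * cnj (mob p z) / cnj w))"

definition side_refl :: "nat \<Rightarrow> complex \<Rightarrow> complex" where
  "side_refl i = geo_refl (tri_vert i) (tri_vert ((i + 1) mod 3))"

text \<open>The group generated by the three side reflections (each is an involution).\<close>
inductive_set refl_group :: "(complex \<Rightarrow> complex) set" where
  id_in: "id \<in> refl_group"
| step: "g \<in> refl_group \<Longrightarrow> i < 3 \<Longrightarrow> side_refl i \<circ> g \<in> refl_group"

definition Vert :: "complex set" where
  "Vert = {g (tri_vert i) | g i. g \<in> refl_group \<and> i < 3}"

definition adj :: "complex \<Rightarrow> complex \<Rightarrow> bool" where
  "adj v w \<longleftrightarrow> (\<exists>g\<in>refl_group. \<exists>i<3. \<exists>j<3. i \<noteq> j \<and> v = g (tri_vert i) \<and> w = g (tri_vert j))"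

definition gdist :: "complex \<Rightarrow> complex \<Rightarrow> nat" where
  "gdist o0 v = (LEAST n. (adj ^^ n) o0 v)"

definition Gamma_ball :: "complex \<Rightarrow> nat \<Rightarrow> complex set" where
  "Gamma_ball o0 m = {v \<in> Vert. gdist o0 v \<le> m}"

definition topple :: "complex set \<Rightarrow> complex \<Rightarrow> (complex \<Rightarrow> int) \<Rightarrow> (complex \<Rightarrow> int)" where
  "topple S v \<psi> = (\<lambda>u. if u = v then \<psi> u - 7
                       else if u \<in> S \<and> adj v u then \<psi> u + 1 else \<psi> u)"

fun run_topplings :: "complex set \<Rightarrow> (complex \<Rightarrow> int) \<Rightarrow> complex list \<Rightarrow> (complex \<Rightarrow> int)" where
  "run_topplings S \<psi> [] = \<psi>"
| "run_topplings S \<psi> (v # vs) = run_topplings S (topple S v \<psi>) vs"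

fun legal_seq :: "complex set \<Rightarrow> (complex \<Rightarrow> int) \<Rightarrow> complex list \<Rightarrow> bool" where
  "legal_seq S \<psi> [] = True"
| "legal_seq S \<psi> (v # vs) = (v \<in> S \<and> \<psi> v \<ge> 7 \<and> legal_seq S (topple S v \<psi>) vs)"

definition stable :: "complex set \<Rightarrow> (complex \<Rightarrow> int) \<Rightarrow> bool" where
  "stable S \<psi> \<longleftrightarrow> (\<forall>v\<in>S. \<psi> v < 7)"

definition is_relaxation :: "complex set \<Rightarrow> (complex \<Rightarrow> int) \<Rightarrow> complex list \<Rightarrow> bool" where
  "is_relaxation S \<psi> vs \<longleftrightarrow> legal_seq S \<psi> vs \<and> stable S (run_topplings S \<psi> vs)"

text \<open>Toppling function: number of topplings at v in a relaxation (choice-independent).\<close>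
definition toppling_fun :: "complex set \<Rightarrow> (complex \<Rightarrow> int) \<Rightarrow> complex \<Rightarrow> nat" where
  "toppling_fun S \<psi> v = count_list (SOME vs. is_relaxation S \<psi> vs) v"

definition phiP :: "complex set \<Rightarrow> complex set \<Rightarrow> complex \<Rightarrow> int" where
  "phiP S P = (\<lambda>u. if u \<in> S then 6 + (if u \<in> P then 1 else 0) else 0)"

end

theory Submission
  imports Defs "HOL-Analysis.Product_Vector"
begin

text \<open>The relaxation is a succession of waves: as long as a grain of \<^term>\<open>P\<close> lies in
\<open>\<Gamma>\<^sub>j\<close>, all vertices of \<open>\<Gamma>\<^sub>j\<close> topple once, which changes the state only outside
\<open>\<Gamma>\<^sub>j\<^sub>-\<^sub>1\<close> (7-regularity), and the argument repeats on \<open>\<Gamma>\<^sub>j\<^sub>-\<^sub>1\<close>.  By the least action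
principle every relaxation has the resulting toppling numbers, provided the final state is stable;
this amounts to strict subharmonicity of the distance \<open>L\<close>.

To see that \<open>\<Sum> (L u - L v) \<ge> 1\<close> over the neighbours \<open>u\<close> of \<open>v\<close>, consider the geodesics through
midpoints of edges (axes of Petrie polygons).  Each edge is crossed by exactly two of them, so that
\<open>2 L(v)\<close> is the number of them separating \<open>v\<close> from \<open>O\<close>.  Seven of them cut off the corners at
\<open>v\<close>, each crossing two consecutive edges at \<open>v\<close>, and corners at cyclic distance three lie beyond
disjoint lines, so \<open>O\<close> lies beyond at most three of the seven.

Discreteness of the tiling is obtained arithmetically: with \<open>\<lambda> = 2 cos (2\<pi>/7)\<close>, the products of
vertices with normals of these geodesics are elements of \<open>1 + 2\<int>[\<lambda>]\<close> whose two other
conjugates are bounded because the conjugate forms are definite; this forces absolute value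
at least 1.\<close>

section \<open>Arithmetic of the cubic field\<close>

definition lam :: real where "lam = 2 * cos (2 * pi / 7)"

lemma lam_gt_1: "lam > 1"
proof -
  have "cos (2 * pi / 7) > cos (pi / 3)"
    by (rule cos_monotone_0_pi) (auto simp: field_simps)
  thus ?thesis by (simp add: lam_def cos_60)
qed

lemma lam_cubic: "lam ^ 3 = 1 + 2 * lam - lam ^ 2"
proof -
  define x where "x = 2 * pi / 7"
  define c where "c = cos x"
  have c3: "cos (3 * x) = 4 * c ^ 3 - 3 * c"
    unfolding c_def by (rule cos_treble_cos)
  have c4: "cos (4 * x) = 2 * (2 * c ^ 2 - 1) ^ 2 - 1"
    using cos_double_cos[of "2 * x"] cos_double_cos[of x] by (simp add: c_def)
  have "4 * x = 2 * pi - 3 * x" by (simp add: x_def)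
  hence "cos (4 * x) = cos (3 * x)"
    by (simp only: cos_diff) simp
  hence "(c - 1) * (8 * c ^ 3 + 4 * c ^ 2 - 4 * c - 1) = 0"
    unfolding c3 c4 by algebra
  moreover have "c \<noteq> 1"
  proof -
    have "cos x < cos 0" by (rule cos_monotone_0_pi) (auto simp: x_def)
    thus ?thesis by (simp add: c_def)
  qed
  ultimately have "8 * c ^ 3 + 4 * c ^ 2 - 4 * c - 1 = 0" by simp
  moreover have "lam = 2 * c" by (simp add: lam_def c_def x_def)
  ultimately show ?thesis by algebra
qed

lemma lam_bounds: "1.2469 < lam" "lam < 1.247"
proof -
  define f :: "real \<Rightarrow> real" where "f = (\<lambda>x. x ^ 3 + x ^ 2 - 2 * x - 1)"
  have root: "f lam = 0" using lam_cubic by (simp add: f_def)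
  have mono: "f x < f y" if "1 \<le> x" "x < y" for x y
  proof -
    have "f y - f x = (y - x) * (x * x + x * y + y * y + x + y - 2)"
      by (simp add: f_def power2_eq_square power3_eq_cube algebra_simps)
    moreover have "1 * 1 \<le> x * x" "1 * 1 \<le> x * y" "1 * 1 \<le> y * y"
      using that by (intro mult_mono; simp)+
    hence "x * x + x * y + y * y + x + y - 2 > 0" using that by linarith
    ultimately have "f y - f x > 0" using that by simp
    thus ?thesis by simp
  qed
  have "f 1.2469 < 0" "f 1.247 > 0" by (simp_all add: f_def power2_eq_square power3_eq_cube)
  show "1.2469 < lam"
    using mono[of lam "1.2469"] \<open>f 1.2469 < 0\<close> root lam_gt_1
    by (metis less_irrefl linorder_neqE_linordered_idom order_less_imp_le order_less_asym)
  show "lam < 1.247"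
  proof (rule ccontr)
    assume "\<not> lam < 1.247"
    hence "1.247 < lam \<or> lam = 1.247" by linarith
    thus False using mono[of "1.247" lam] \<open>f 1.247 > 0\<close> root
        by (elim disjE) (simp, metis less_irrefl)
  qed
qed

text \<open>A function \<open>f\<close> with \<open>zlam f\<close> represents the element \<open>f \<lambda>\<close> of \<open>\<int>[\<lambda>]\<close> together with its
conjugates, the values of \<open>f\<close> at the other two roots.\<close>

definition roots :: "real set" where "roots = {u. u ^ 3 = 1 + 2 * u - u ^ 2}"

definition zlam :: "(real \<Rightarrow> real) \<Rightarrow> bool" where
  "zlam f \<longleftrightarrow> (\<exists>i j k :: int. \<forall>u\<in>roots. f u = of_int i + of_int j * u + of_int k * u ^ 2)"

lemma zlam_const: "zlam (\<lambda>u. of_int i)"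
  unfolding zlam_def by (rule exI[of _ i], rule exI[of _ 0], rule exI[of _ 0]) simp

lemma zlam_add: assumes "zlam f" "zlam g" shows "zlam (\<lambda>u. f u + g u)"
proof -
  obtain i j k where 1: "\<forall>u\<in>roots. f u = of_int i + of_int j * u + of_int k * u ^ 2"
    using assms(1) unfolding zlam_def by blast
  obtain i' j' k' where 2: "\<forall>u\<in>roots. g u = of_int i' + of_int j' * u + of_int k' * u ^ 2"
    using assms(2) unfolding zlam_def by blast
  show ?thesis unfolding zlam_def
    by (rule exI[of _ "i + i'"], rule exI[of _ "j + j'"], rule exI[of _ "k + k'"])
      (use 1 2 in \<open>auto simp: algebra_simps\<close>)
qed

lemma zlam_minus: assumes "zlam f" shows "zlam (\<lambda>u. - f u)"
proof -
  obtain i j k where 1: "\<forall>u\<in>roots. f u = of_int i + of_int j * u + of_int k * u ^ 2"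
    using assms(1) unfolding zlam_def by blast
  show ?thesis unfolding zlam_def
    by (rule exI[of _ "- i"], rule exI[of _ "- j"], rule exI[of _ "- k"])
      (use 1 in \<open>auto simp: algebra_simps\<close>)
qed

lemma zlam_diff: assumes "zlam f" "zlam g" shows "zlam (\<lambda>u. f u - g u)"
  using zlam_add[OF assms(1) zlam_minus[OF assms(2)]] by simp

lemma zlam_mult_id: assumes "zlam f" shows "zlam (\<lambda>u. u * f u)"
proof -
  obtain i j k where 1: "\<forall>u\<in>roots. f u = of_int i + of_int j * u + of_int k * u ^ 2"
    using assms(1) unfolding zlam_def by blast
  \<comment> \<open>The coefficients come from reducing \<open>of_int k * u ^ 3\<close> by the
    cubic.\<close>
  have "u * f u = of_int k + of_int (i + 2 * k) * u + of_int (j - k) * u ^ 2" if "u \<in> roots" for u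
  proof -
    have "u ^ 3 = 1 + 2 * u - u ^ 2" using that by (simp add: roots_def)
    moreover have "f u = of_int i + of_int j * u + of_int k * u ^ 2" using 1 that by blast
    ultimately show ?thesis by simp algebra
  qed
  thus ?thesis unfolding zlam_def by blast
qed

text \<open>The conjugates of \<open>lam\<close>: \<open>lam\<^sup>2 - 2\<close> is
  \<open>2 * cos (4 * pi / 7)\<close> by angle doubling, and the third root follows since the three
  roots add up to -1.\<close>

lemma roots_lam: "lam \<in> roots" "lam\<^sup>2 - 2 \<in> roots" "1 - lam - lam\<^sup>2 \<in> roots"
  unfolding roots_def using lam_cubic by (simp_all, algebra+)

text \<open>If \<open>a lam\<close> were below 1 in absolute value, all three conjugates would be
  small; interpolation then forces \<open>K = 0\<close>, next \<open>J = 0\<close>, and an odd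
  integer strictly between -1 and 1 remains. The bounds on the other conjugates are those that
  \<open>qf_odd_abs_ge_1\<close> gets from the definite forms.\<close>

lemma zlam_odd_abs_ge_1:
  assumes t: "zlam t" and a: "\<And>u. u \<in> roots \<Longrightarrow> a u = 1 + 2 * t u"
    and b1: "\<bar>a (lam\<^sup>2 - 2)\<bar> \<le> 1.668" and b2: "\<bar>a (1 - lam - lam\<^sup>2)\<bar> \<le> 2.87"
  shows "\<bar>a lam\<bar> \<ge> 1"
proof (rule ccontr)
  assume "\<not> ?thesis"
  hence b0: "\<bar>a lam\<bar> < 1" by simp
  obtain i j k where t: "\<forall>u\<in>roots. t u = of_int i + of_int j * u + of_int k * u ^ 2"
    using t unfolding zlam_def by blast
  define I J K where "I = real_of_int i" and "J = real_of_int j" and "K = real_of_int k"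
  define l m n where "l = lam" and "m = l\<^sup>2 - 2" and "n = 1 - l - l\<^sup>2"
  have b: "\<bar>a l\<bar> < 1" "\<bar>a m\<bar> \<le> 1.668" "\<bar>a n\<bar> \<le> 2.87"
    using b0 b1 b2 by (simp_all only: l_def m_def n_def)
  note lb = lam_bounds[folded l_def]
  have l2: "1.2469 * 1.2469 \<le> l ^ 2" "l ^ 2 \<le> 1.247 * 1.247"
    unfolding power2_eq_square using lb by (intro mult_mono; simp)+
  have lm: "l - m \<le> 1.6923" "l - m \<ge> 0" and ln: "l - n \<le> 3.05" "l - n \<ge> 0"
    and mn: "m - n \<le> 1.358" "m - n \<ge> 0" and lm': "l - m \<ge> 1.69"
    using lb l2 by (auto simp: m_def n_def l_def)
  have al: "a l = 1 + 2 * (I + J * l + K * l\<^sup>2)" and am: "a m = 1 + 2 * (I + J * m + K * m\<^sup>2)"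
    and an: "a n = 1 + 2 * (I + J * n + K * n\<^sup>2)"
    using t a roots_lam by (auto simp: l_def m_def n_def I_def J_def K_def)
  have cub: "l ^ 3 = 1 + 2 * l - l ^ 2" using lam_cubic by (simp add: l_def)
  \<comment> \<open>Lagrange interpolation; 7 is the square root of the discriminant.\<close>
  have "14 * K = a l * (m - n) - a m * (l - n) + a n * (l - m)"
    unfolding al am an using cub unfolding m_def n_def by algebra
  moreover have "\<bar>a l * (m - n)\<bar> \<le> 1 * 1.358" "\<bar>a m * (l - n)\<bar> \<le> 1.668 * 3.05"
    "\<bar>a n * (l - m)\<bar> \<le> 2.87 * 1.6923"
    unfolding abs_mult using b lm ln mn by (intro mult_mono; simp)+
  ultimately have "14 * \<bar>K\<bar> \<le> 1 * 1.358 + 1.668 * 3.05 + 2.87 * 1.6923"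
    by linarith
  hence "\<bar>K\<bar> < 1" by simp
  hence K: "K = 0" by (simp add: K_def)
  have "2 * J * (l - m) = a l - a m" unfolding al am K by algebra
  moreover have "\<bar>a m\<bar> \<le> 2" using b(2) by simp
  with b(1) have "\<bar>a l - a m\<bar> < 3" by linarith
  ultimately have "\<bar>2 * J * (l - m)\<bar> < 3" by simp
  hence "\<bar>J\<bar> * (l - m) < 1.5" using lm by (simp add: abs_mult)
  moreover have "\<bar>J\<bar> * 1.69 \<le> \<bar>J\<bar> * (l - m)" using lm' by (intro mult_left_mono) auto
  ultimately have "\<bar>J\<bar> < 1" by simp
  hence J: "J = 0" by (simp add: J_def)
  have "-1 < 1 + 2 * I" "1 + 2 * I < 1" using b(1) al unfolding J K by auto
  hence "-1 < i" "i < 0" by (simp_all add: I_def)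
  thus False by simp
qed

text \<open>The Gram matrix of an adjacent triple of vertices has diagonal entries \<open>2 - \<lambda>\<close> and all other
entries \<open>\<lambda>\<close>; \<open>qf u\<close> is its conjugate under \<open>\<lambda> \<mapsto> u\<close>, of signature (1,2) for \<open>u = \<lambda>\<close> and definite
at the other two roots.\<close>

definition qf :: "real \<Rightarrow> real \<times> real \<times> real \<Rightarrow> real \<times> real \<times> real \<Rightarrow> real" where
  "qf u = (\<lambda>(a, b, c) (a', b', c').
     (2 - 2 * u) * (a * a' + b * b' + c * c') + u * (a + b + c) * (a' + b' + c'))"

text \<open>This is Cauchy-Schwarz for the form, positive definite in this range of
  \<open>u\<close>, and the linear functional \<open>a - b - c\<close>, which gives the product of a
  vertex with a normal.\<close>

lemma qf_bound:
  assumes "qf u (a, b, c) (a, b, c) = 2 - u" "- 2 < u" "u < 0"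
  shows "(2 + u) * (1 - u) * (a - b - c)\<^sup>2 \<le> (3 + u) * (2 - u)"
proof -
  have pos: "0 \<le> (2 - 2 * u) * (x * x + y * y + z * z) + u * (x + y + z) * (x + y + z)" for x y z
  proof -
    have "(2 - 2 * u) * (x * x + y * y + z * z) + u * (x + y + z) * (x + y + z)
       = (2 + u) * (x\<^sup>2 + y\<^sup>2 + z\<^sup>2) + (- u) * ((x - y)\<^sup>2 + (y - z)\<^sup>2 + (x - z)\<^sup>2)"
      by (simp add: power2_eq_square algebra_simps)
    also have "\<dots> \<ge> 0"
    proof -
      have "0 \<le> (2 + u) * (x\<^sup>2 + y\<^sup>2 + z\<^sup>2)"
        using assms(2) by (intro mult_nonneg_nonneg[of "2 + u"]) auto
      moreover have "0 \<le> (- u) * ((x - y)\<^sup>2 + (y - z)\<^sup>2 + (x - z)\<^sup>2)"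
        using assms(3) by (intro mult_nonneg_nonneg[of "- u"]) auto
      ultimately show ?thesis by linarith
    qed
    finally show ?thesis .
  qed
  define s where "s = a - b - c"
  define k where "k = 3 + u"
  have k: "k > 0" using assms by (simp add: k_def)
  \<comment> \<open>\<open>(1 + u, -1, -1)\<close> represents the functional up to a factor;
    subtracting \<open>s\<close> times this vector projects \<open>k\<close> times
    \<open>(a, b, c)\<close> orthogonally to the kernel of the functional.\<close>
  let ?x = "k * a - s * (1 + u)" and ?y = "k * b + s" and ?z = "k * c + s"
  have "(2 - 2 * u) * (a * a + b * b + c * c) + u * (a + b + c) * (a + b + c) = 2 - u"
    using assms(1) by (simp add: qf_def)
  hence "(2 - 2 * u) * (?x * ?x + ?y * ?y + ?z * ?z) + u * (?x + ?y + ?z) * (?x + ?y + ?z)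
     = k * (k * (2 - u) - (2 + u) * (1 - u) * s\<^sup>2)"
    unfolding s_def k_def by algebra
  with pos[of ?x ?y ?z] k have "k * (2 - u) - (2 + u) * (1 - u) * s\<^sup>2 \<ge> 0"
    by (simp add: zero_le_mult_iff)
  thus ?thesis by (simp add: k_def s_def)
qed

lemma qf_odd_abs_ge_1:
  assumes "zlam t" "\<And>u. u \<in> roots \<Longrightarrow> a u - b u - c u = 1 + 2 * t u"
    and q: "\<And>u. u \<in> roots \<Longrightarrow> qf u (a u, b u, c u) (a u, b u, c u) = 2 - u"
  shows "\<bar>a lam - b lam - c lam\<bar> \<ge> 1"
proof (rule zlam_odd_abs_ge_1[where a = "\<lambda>u. a u - b u - c u", OF assms(1,2)])
  define l where "l = lam"
  note lb = lam_bounds[folded l_def]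
  have l2: "1.2469 * 1.2469 \<le> l ^ 2" "l ^ 2 \<le> 1.247 * 1.247"
    unfolding power2_eq_square using lb by (intro mult_mono; simp)+
  have bound: "\<bar>s\<bar> \<le> r" if h: "(2 + u) * (1 - u) * s\<^sup>2 \<le> (3 + u) * (2 - u)" 
      and u: "x \<le> u" "u \<le> y" "y < 0" "-2 < x" and r: "0 \<le> r"
          "(3 + y) * (2 - x) \<le> (2 + x) * (1 - y) * r\<^sup>2" for u s r x y :: real
  proof -
    have "(2 + x) * (1 - y) * s\<^sup>2 \<le> (2 + u) * (1 - u) * s\<^sup>2"
      using u by (intro mult_right_mono mult_mono) auto
    also note h
    also have "(3 + u) * (2 - u) \<le> (3 + y) * (2 - x)" using u by (intro mult_mono) auto
    also note r(2)
    finally have "s\<^sup>2 \<le> r\<^sup>2" using u by (simp add: mult_le_cancel_left)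
    thus ?thesis using r(1) by (metis abs_of_nonneg abs_le_square_iff)
  qed
  \<comment> \<open>The last two arguments of \<open>bound\<close> enclose the conjugate; 1.668, and
    2.87 below, lie slightly above the bounds that these enclosures yield.\<close>
  show "\<bar>a (lam\<^sup>2 - 2) - b (lam\<^sup>2 - 2) - c (lam\<^sup>2 - 2)\<bar> \<le> 1.668"
    by (rule bound[OF qf_bound[OF q[OF roots_lam(2)]], of "-0.4453" "-0.4449"])
      (use lb l2 in \<open>auto simp: l_def power2_eq_square\<close>)
  show "\<bar>a (1 - lam - lam\<^sup>2) - b (1 - lam - lam\<^sup>2) - c (1 - lam - lam\<^sup>2)\<bar> \<le> 2.87"
    by (rule bound[OF qf_bound[OF q[OF roots_lam(3)]], of "-1.80201" "-1.8016"])
      (use lb l2 in \<open>auto simp: l_def power2_eq_square\<close>)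
qed

section \<open>Triangles in Minkowski space\<close>

type_synonym vec = "real \<times> complex"

text \<open>The Minkowski form, scaled so that the Gram matrices of faces have entries in \<open>\<int>[\<lambda>]\<close>;
vertices are unit vectors of the unscaled form.\<close>

definition mform :: "vec \<Rightarrow> vec \<Rightarrow> real" where
  "mform x y = (2 - lam) * (fst x * fst y - Re (snd x) * Re (snd y) - Im (snd x) * Im (snd y))"

lemma mform_commute: "mform x y = mform y x"
  by (simp add: mform_def algebra_simps)

lemma mform_linear [simp]:
  "mform (x + y) z = mform x z + mform y z" "mform z (x + y) = mform z x + mform z y"
  "mform (x - y) z = mform x z - mform y z" "mform z (x - y) = mform z x - mform z y"
  "mform (- x) z = - mform x z" "mform z (- x) = - mform z x"
  "mform (r *\<^sub>R x) z = r * mform x z" "mform z (r *\<^sub>R x) = r * mform z x"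
  by (simp_all add: mform_def algebra_simps)

text \<open>\<open>lam *\<^sub>R (x + y) - z\<close> is the mirror image of \<open>z\<close> in the side through \<open>x\<close> and \<open>y\<close>.\<close>

inductive tri :: "vec \<Rightarrow> vec \<Rightarrow> vec \<Rightarrow> vec \<Rightarrow> vec \<Rightarrow> vec \<Rightarrow> bool" for a b c where
  base: "tri a b c a b c"
| swap12: "tri a b c x y z \<Longrightarrow> tri a b c y x z"
| swap23: "tri a b c x y z \<Longrightarrow> tri a b c x z y"
| flip: "tri a b c x y z \<Longrightarrow> tri a b c x y (lam *\<^sub>R (x + y) - z)"

lemma tri_trans:
  assumes "tri x y z u v w" "tri a b c x y z"
  shows "tri a b c u v w"
  using assms by induction (auto intro: tri.intros)

text \<open>Swaps and flips are involutions.\<close>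

lemma tri_sym:
  assumes "tri a b c x y z"
  shows "tri x y z a b c"
  using assms
proof induction
  case base
  show ?case by (rule tri.base)
next
  case (swap12 x y z)
  show ?case by (rule tri_trans[OF swap12.IH]) (rule tri.swap12[OF tri.base])
next
  case (swap23 x y z)
  show ?case by (rule tri_trans[OF swap23.IH]) (rule tri.swap23[OF tri.base])
next
  case (flip x y z)
  have "tri x y (lam *\<^sub>R (x + y) - z) x y z"
    using tri.flip[OF tri.base[of x y "lam *\<^sub>R (x + y) - z"]] by simp
  thus ?case by (rule tri_trans[OF flip.IH])
qed

section \<open>Coordinates of vertices in all conjugates\<close>

type_synonym fam = "real \<Rightarrow> real \<times> real \<times> real"

text \<open>Coordinates of a vertex with respect to a face, as functions of the conjugate \<open>u\<close> of \<open>\<lambda>\<close>.\<close>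

definition adm :: "fam \<Rightarrow> bool" where
  "adm F \<longleftrightarrow> zlam (\<lambda>u. fst (F u)) \<and> zlam (\<lambda>u. fst (snd (F u))) \<and> zlam (\<lambda>u. snd (snd (F u))) \<and>
     (\<exists>t. zlam t \<and> (\<forall>u\<in>roots. fst (F u) + fst (snd (F u)) + snd (snd (F u)) = 1 + 2 * t u)) \<and>
     (\<forall>u. qf u (F u) (F u) = 2 - u)"

definition comb :: "vec \<Rightarrow> vec \<Rightarrow> vec \<Rightarrow> fam \<Rightarrow> vec" where
  "comb a b c F = fst (F lam) *\<^sub>R a + fst (snd (F lam)) *\<^sub>R b + snd (snd (F lam)) *\<^sub>R c"

lemma qf_commute: "qf u x y = qf u y x"
  by (simp add: qf_def split_beta algebra_simps)

lemma adm_zlam: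
  assumes "adm F"
  shows "zlam (\<lambda>u. fst (F u))" "zlam (\<lambda>u. fst (snd (F u)))" "zlam (\<lambda>u. snd (snd (F u)))"
  using assms by (simp_all add: adm_def)

lemma adm_qf: "adm F \<Longrightarrow> qf u (F u) (F u) = 2 - u"
  by (simp add: adm_def)

lemma adm_odd_sumE:
  assumes "adm F"
  obtains t where "zlam t" "\<forall>u\<in>roots. fst (F u) + fst (snd (F u)) + snd (snd (F u)) = 1 + 2 * t u"
  using assms unfolding adm_def by (elim conjE exE) simp

text \<open>The flip is a reflection for every value of \<open>u\<close>: with norms
  \<open>2 - u\<close> and mutual products \<open>u\<close>, the new product with \<open>X u\<close>
  is \<open>u * (2 - u + u) - u = u\<close>. The coordinate sum stays odd because \<open>u\<close>
  multiplies the sum of two odd elements, which is even.\<close>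

lemma adm_flip:
  assumes "adm X" "adm Y" "adm Z"
    and q: "\<And>u. qf u (X u) (Y u) = u" "\<And>u. qf u (Y u) (Z u) = u" "\<And>u. qf u (X u) (Z u) = u"
  shows "adm (\<lambda>u. u *\<^sub>R (X u + Y u) - Z u)"
    and "qf u (X u) (u *\<^sub>R (X u + Y u) - Z u) = u"
    and "qf u (Y u) (u *\<^sub>R (X u + Y u) - Z u) = u"
proof -
  note zls = zlam_diff zlam_add zlam_mult_id
  obtain t1 where t1: "zlam t1" "\<forall>u\<in>roots. fst (X u) + fst (snd (X u)) + snd (snd (X u))
      = 1 + 2 * t1 u"
    using assms(1) by (rule adm_odd_sumE) (rule that)
  obtain t2 where t2: "zlam t2" "\<forall>u\<in>roots. fst (Y u) + fst (snd (Y u)) + snd (snd (Y u))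
      = 1 + 2 * t2 u"
    using assms(2) by (rule adm_odd_sumE) (rule that)
  obtain t3 where t3: "zlam t3" "\<forall>u\<in>roots. fst (Z u) + fst (snd (Z u)) + snd (snd (Z u))
      = 1 + 2 * t3 u"
    using assms(3) by (rule adm_odd_sumE) (rule that)
  note qq = adm_qf[OF assms(1)] adm_qf[OF assms(2)] adm_qf[OF assms(3)]
  note qc = qf_commute
  have qlin: "qf u x (r *\<^sub>R (y + z) - w) = r * (qf u x y + qf u x z) - qf u x w" for u x y z w r
    by (simp add: qf_def split_beta algebra_simps)
  have qx: "qf u (X u) (u *\<^sub>R (X u + Y u) - Z u) = u"
    and qy: "qf u (Y u) (u *\<^sub>R (X u + Y u) - Z u) = u" 
    and qz: "qf u (Z u) (u *\<^sub>R (X u + Y u) - Z u) = 2 * u\<^sup>2 - (2 - u)" for u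
    unfolding qlin q qq qc[of u "Y u" "X u"] qc[of u "Z u" "X u"] qc[of u "Z u" "Y u"]
    by (simp_all add: algebra_simps power2_eq_square)
  show "qf u (X u) (u *\<^sub>R (X u + Y u) - Z u) = u" "qf u (Y u) (u *\<^sub>R (X u + Y u) - Z u) = u"
    by (rule qx qy)+
  have "qf u (u *\<^sub>R (X u + Y u) - Z u) (u *\<^sub>R (X u + Y u) - Z u) = 2 - u" for u
    using qlin[of u "u *\<^sub>R (X u + Y u) - Z u" u "X u" "Y u" "Z u"]
    unfolding qc[of u "u *\<^sub>R (X u + Y u) - Z u" "X u"] qc[of u "u *\<^sub>R (X u + Y u) - Z u" "Y u"]
      qc[of u "u *\<^sub>R (X u + Y u) - Z u" "Z u"] qx qy qz
    by (simp add: algebra_simps power2_eq_square)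
  moreover have "\<exists>t. zlam t \<and> (\<forall>u\<in>roots. fst (u *\<^sub>R (X u + Y u) - Z u) +
     fst (snd (u *\<^sub>R (X u + Y u) - Z u)) + snd (snd (u *\<^sub>R (X u + Y u) - Z u)) = 1 + 2 * t u)"
  proof (intro exI conjI ballI)
    show "zlam (\<lambda>u. u * (of_int 1 + (t1 u + t2 u)) - (t3 u + of_int 1))"
      by (intro zls t1(1) t2(1) t3(1) zlam_const)
    fix u assume "u \<in> roots"
    with t1(2) t2(2) t3(2) have
      "fst (X u) + fst (snd (X u)) + snd (snd (X u)) = 1 + 2 * t1 u"
      "fst (Y u) + fst (snd (Y u)) + snd (snd (Y u)) = 1 + 2 * t2 u"
      "fst (Z u) + fst (snd (Z u)) + snd (snd (Z u)) = 1 + 2 * t3 u" by blast+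
    note e = this
    show "fst (u *\<^sub>R (X u + Y u) - Z u) +
     fst (snd (u *\<^sub>R (X u + Y u) - Z u)) + snd (snd (u *\<^sub>R (X u + Y u) - Z u))
       = 1 + 2 * (u * (of_int 1 + (t1 u + t2 u)) - (t3 u + of_int 1))"
      by simp (use e in algebra)
  qed
  ultimately show "adm (\<lambda>u. u *\<^sub>R (X u + Y u) - Z u)"
    unfolding adm_def
    by (auto intro!: zls adm_zlam[OF assms(1)] adm_zlam[OF assms(2)] adm_zlam[OF assms(3)])
qed

text \<open>The coordinates are built as families in \<open>u\<close> and not only at
  \<open>lam\<close>, where the form is indefinite: the same relations at the other two roots, where
  it is definite, bound the conjugates of the coordinates.\<close>

lemma tri_coords:
  assumes "tri a b c x y z"
  shows "\<exists>X Y Z. adm X \<and> adm Y \<and> adm Z \<and>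
     (\<forall>u. qf u (X u) (Y u) = u \<and> qf u (Y u) (Z u) = u \<and> qf u (X u) (Z u) = u) \<and>
     x = comb a b c X \<and> y = comb a b c Y \<and> z = comb a b c Z"
  using assms
proof induction
  case base
  have z: "zlam (\<lambda>_. 0)" "zlam (\<lambda>_. 1)" using zlam_const[of 0] zlam_const[of 1] by simp_all
  show ?case
    by (rule exI[of _ "\<lambda>_. (1, 0, 0)"], rule exI[of _ "\<lambda>_. (0, 1, 0)"], rule exI[of _
        "\<lambda>_. (0, 0, 1)"])
      (use z in \<open>auto simp: adm_def comb_def qf_def intro!: exI[of _ "\<lambda>_. 0"]\<close>)
next
  case (swap12 x y z)
  then obtain X Y Z where "adm X" "adm Y" "adm Z"
    "\<And>u. qf u (X u) (Y u) = u" "\<And>u. qf u (Y u) (Z u) = u" "\<And>u. qf u (X u) (Z u) = u"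
    "x = comb a b c X" "y = comb a b c Y" "z = comb a b c Z"
    by blast
  thus ?case by (intro exI[of _ Y] exI[of _ X] exI[of _ Z]) (simp add: qf_commute)
next
  case (swap23 x y z)
  then obtain X Y Z where "adm X" "adm Y" "adm Z"
    "\<And>u. qf u (X u) (Y u) = u" "\<And>u. qf u (Y u) (Z u) = u" "\<And>u. qf u (X u) (Z u) = u"
    "x = comb a b c X" "y = comb a b c Y" "z = comb a b c Z"
    by blast
  thus ?case by (intro exI[of _ X] exI[of _ Z] exI[of _ Y]) (simp add: qf_commute)
next
  case (flip x y z)
  then obtain X Y Z where XYZ: "adm X" "adm Y" "adm Z"
    "\<And>u. qf u (X u) (Y u) = u" "\<And>u. qf u (Y u) (Z u) = u" "\<And>u. qf u (X u) (Z u) = u"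
    and eq: "x = comb a b c X" "y = comb a b c Y" "z = comb a b c Z"
    by blast
  have "lam *\<^sub>R (x + y) - z = comb a b c (\<lambda>u. u *\<^sub>R (X u + Y u) - Z u)"
    unfolding eq comb_def by (simp add: algebra_simps)
  thus ?case using adm_flip[OF XYZ] XYZ eq
    by (intro exI[of _ X] exI[of _ Y] exI[of _ "\<lambda>u. u *\<^sub>R (X u + Y u) - Z u"]) blast
qed

section \<open>Gram matrices of faces and normals of lines\<close>

definition gram :: "vec \<Rightarrow> vec \<Rightarrow> vec \<Rightarrow> bool" where
  "gram x y z \<longleftrightarrow> mform x x = 2 - lam \<and> mform y y = 2 - lam \<and> mform z z = 2 - lam \<and>
     mform x y = lam \<and> mform x z = lam \<and> mform y z = lam"

lemma gram_swap: "gram x y z \<Longrightarrow> gram y x z" "gram x y z \<Longrightarrow> gram x z y"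
  by (simp_all add: gram_def mform_commute[of y x] mform_commute[of z y])

lemma gram_flip:
  assumes "gram x y z"
  shows "gram x y (lam *\<^sub>R (x + y) - z)"
proof -
  have g: "mform x x = 2 - lam" "mform y y = 2 - lam" "mform z z = 2 - lam" "mform x y = lam"
      "mform x z = lam" "mform y z = lam"
    "mform y x = lam" "mform z x = lam" "mform z y = lam"
    using assms by (simp_all add: gram_def mform_commute[of y x] mform_commute[of z x]
        mform_commute[of z y])
  show ?thesis unfolding gram_def mform_linear g by (simp add: algebra_simps)
qed

lemma tri_gram:
  assumes "tri a b c x y z" "gram a b c"
  shows "gram x y z"
  using assms
  by induction (auto intro: gram_swap gram_flip)

text \<open>Normal of the geodesic through the midpoints of \<open>xy\<close> and \<open>xz\<close>, scaled to have products
1, -1, -1 with \<open>x\<close>, \<open>y\<close>, \<open>z\<close>; this uses \<open>\<lambda> (\<lambda>\<^sup>2 + \<lambda> - 2) = 1\<close>.\<close>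

definition nrm :: "vec \<Rightarrow> vec \<Rightarrow> vec \<Rightarrow> vec" where
  "nrm x y z = lam *\<^sub>R (y + z - (1 + lam) *\<^sub>R x)"

lemma mform_nrm:
  assumes "gram x y z"
  shows "mform (nrm x y z) x = 1" "mform (nrm x y z) y = - 1" "mform (nrm x y z) z = - 1"
    "mform (nrm x y z) (nrm x y z) = - lam * (3 + lam)"
proof -
  have g: "mform x x = 2 - lam" "mform y y = 2 - lam" "mform z z = 2 - lam" "mform x y = lam"
      "mform x z = lam" "mform y z = lam"
    "mform y x = lam" "mform z x = lam" "mform z y = lam"
    using assms by (simp_all add: gram_def mform_commute[of y x] mform_commute[of z x]
        mform_commute[of z y])
  have 1: "mform (nrm x y z) x = lam ^ 3 + lam ^ 2 - 2 * lam"
      "mform (nrm x y z) y = 2 * lam - lam ^ 2 - lam ^ 3"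
    "mform (nrm x y z) z = 2 * lam - lam ^ 2 - lam ^ 3"
    unfolding nrm_def mform_linear g by (simp_all add: algebra_simps power2_eq_square
        power3_eq_cube)
  thus n: "mform (nrm x y z) x = 1" "mform (nrm x y z) y = - 1" "mform (nrm x y z) z = - 1"
    using lam_cubic by simp_all
  have "mform (nrm x y z) (nrm x y z) = lam * (mform (nrm x y z) y + mform (nrm x y z) z - (1 +
      lam) * mform (nrm x y z) x)"
    by (subst (2) nrm_def) simp
  thus "mform (nrm x y z) (nrm x y z) = - lam * (3 + lam)"
    unfolding n by (simp add: algebra_simps)
qed

text \<open>As \<open>nrm a b c\<close> has products 1, -1, -1 with the base face, its product with
  \<open>x\<close> is the first coordinate of \<open>x\<close> minus the other two, which differs
  from the odd coordinate sum by an even element.\<close>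

lemma tri_mform_nrm_abs_ge_1:
  assumes "tri a b c x y z" "gram a b c"
  shows "\<bar>mform (nrm a b c) x\<bar> \<ge> 1"
proof -
  obtain X where X: "adm X" "x = comb a b c X" using tri_coords[OF assms(1)] by blast
  obtain t where t: "zlam t" "\<forall>u\<in>roots. fst (X u) + fst (snd (X u)) + snd (snd (X u)) = 1 + 2 * t u"
    using X(1) by (rule adm_odd_sumE) (rule that)
  have "mform (nrm a b c) x = fst (X lam) - fst (snd (X lam)) - snd (snd (X lam))"
    by (simp add: X(2) comb_def mform_nrm[OF assms(2)])
  moreover have "\<bar>fst (X lam) - fst (snd (X lam)) - snd (snd (X lam))\<bar> \<ge> 1"
  proof (rule qf_odd_abs_ge_1[where a = "\<lambda>u. fst (X u)" and b = "\<lambda>u. fst (snd (X u))" and c =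
      "\<lambda>u. snd (snd (X u))"])
    show "zlam (\<lambda>u. t u - (fst (snd (X u)) + snd (snd (X u))))"
      by (intro zlam_diff zlam_add t(1) adm_zlam[OF X(1)])
    show "fst (X u) - fst (snd (X u)) - snd (snd (X u))
        = 1 + 2 * (t u - (fst (snd (X u)) + snd (snd (X u))))"
      if "u \<in> roots" for u using bspec[OF t(2) that] by simp
  qed (use X(1) in \<open>simp add: adm_qf\<close>)
  ultimately show ?thesis by simp
qed

lemma tri_span:
  assumes "tri a b c x y z"
  obtains p q r where "x = p *\<^sub>R a + q *\<^sub>R b + r *\<^sub>R c"
  using tri_coords[OF assms] unfolding comb_def by blast

section \<open>Faces and lines around a vertex\<close>

lemma vec_eqI: "fst x = fst y \<Longrightarrow> Re (snd x) = Re (snd y) \<Longrightarrow> Im (snd x) = Im (snd y) \<Longrightarrow> x = (y :: vec)"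
  by (simp add: prod_eq_iff complex_eq_iff)

text \<open>The zigzag of a Petrie polygon: the line through the midpoints of \<open>yv\<close> and
  \<open>yx\<close> runs on into the mirror face across \<open>vy\<close>, where it passes through
  the midpoint of the edge from \<open>v\<close> to the image of \<open>x\<close>.\<close>

lemma nrm_flip: "nrm v (lam *\<^sub>R (v + y) - x) y = - nrm y v x"
  by (simp add: nrm_def algebra_simps)

text \<open>The neighbours of \<open>v\<close> in cyclic order when \<open>v\<close>,
  \<open>y\<close>, \<open>z\<close> form a face: each is the mirror image of the last but one in
  the edge between them.\<close>

fun fan :: "vec \<Rightarrow> vec \<Rightarrow> vec \<Rightarrow> nat \<Rightarrow> vec" where
  "fan v y z 0 = y"
| "fan v y z (Suc 0) = z"
| "fan v y z (Suc (Suc i)) = lam *\<^sub>R (v + fan v y z (Suc i)) - fan v y z i"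

text \<open>In each coordinate the recurrence has a constant inhomogeneity and the primitive seventh
  roots of unity with real part \<open>lam / 2\<close> as characteristic roots, so its solutions
  have period 7. The proof unrolls seven steps modulo the cubic.\<close>

lemma fan_period: "fan v y z (i + 7) = fan v y z i"
proof -
  have step: "g 7 = g 0" if r: "\<And>i. g (Suc (Suc i)) = lam * (w + g (Suc i)) - g i" for g ::
      "nat \<Rightarrow> real" and w
  proof -
    have rr: "g 2 = lam * (w + g 1) - g 0" "g 3 = lam * (w + g 2) - g 1"
        "g 4 = lam * (w + g 3) - g 2"
      "g 5 = lam * (w + g 4) - g 3" "g 6 = lam * (w + g 5) - g 4" "g 7 = lam * (w + g 6) - g 5"
      using r[of 0] r[of 1] r[of 2] r[of 3] r[of 4] r[of 5] by (simp_all add: eval_nat_numeral)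
    have "g 3 = (lam + lam\<^sup>2) * w + (lam\<^sup>2 - 1) * g 1 - lam * g 0"
      using rr(1,2) by algebra
    with rr(1,3) have g4: "g 4 = (1 + 2 * lam) * w + (1 - lam\<^sup>2) * (g 0 + g 1)"
      using lam_cubic by algebra
    have "g 5 = (lam + lam\<^sup>2) * w + (lam\<^sup>2 - 1) * g 0 - lam * g 1"
      using rr(1,2,4) g4 lam_cubic by algebra
    moreover from this have "g 6 = lam * w + lam * g 0 - g 1"
      using rr(5) g4 lam_cubic by algebra
    ultimately show "g 7 = g 0"
      using rr(6) lam_cubic by algebra
  qed
  have "fan v y z (i + 7) = fan v y z (i + 0)"
  proof (rule vec_eqI)
    show "fst (fan v y z (i + 7)) = fst (fan v y z (i + 0))"
      by (rule step[where w = "fst v"]) simp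
    show "Re (snd (fan v y z (i + 7))) = Re (snd (fan v y z (i + 0)))"
      by (rule step[where w = "Re (snd v)"]) simp
    show "Im (snd (fan v y z (i + 7))) = Im (snd (fan v y z (i + 0)))"
      by (rule step[where w = "Im (snd v)"]) simp
  qed
  thus ?thesis by simp
qed

text \<open>If the fan consists of vertices, the sum on the right has positive product with every
  vertex, so no vertex lies beyond both of these lines at cyclic distance three.\<close>

lemma nrm_fan_sum:
  "nrm v (fan v y z i) (fan v y z (i + 1)) + nrm v (fan v y z (i + 3)) (fan v y z (i + 4))
      = v + fan v y z (i + 2)"
proof -
  define p q where "p = fan v y z i" and "q = fan v y z (i + 1)"
  have f: "fan v y z (i + 2) = lam *\<^sub>R (v + q) - p"
    "fan v y z (i + 3) = lam *\<^sub>R (v + (lam *\<^sub>R (v + q) - p)) - q"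
    "fan v y z (i + 4) = lam *\<^sub>R (v + (lam *\<^sub>R (v + (lam *\<^sub>R (v + q) - p)) - q)) - (lam *\<^sub>R (v +
        q) - p)"
    by (simp_all add: p_def q_def numeral_eq_Suc)
  show ?thesis
    unfolding f p_def[symmetric] q_def[symmetric] nrm_def
    by (rule vec_eqI; simp; use lam_cubic in algebra)
qed

lemma scaleR_comb:
  fixes x y z :: "'v :: real_vector"
  shows "p *\<^sub>R (p1 *\<^sub>R x + q1 *\<^sub>R y + r1 *\<^sub>R z) + q *\<^sub>R (p2 *\<^sub>R x + q2 *\<^sub>R y + r2 *\<^sub>R z)
      + r *\<^sub>R (p3 *\<^sub>R x + q3 *\<^sub>R y + r3 *\<^sub>R z)
    = (p * p1 + q * p2 + r * p3) *\<^sub>R x + (p * q1 + q * q2 + r * q3) *\<^sub>R y + (p * r1 + q * r2 + r *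
        r3) *\<^sub>R z"
  by (simp add: scaleR_add_left scaleR_add_right add_ac)

lemma nrm_comb:
  fixes x y z :: "'v :: real_vector"
  shows "l *\<^sub>R ((p2 *\<^sub>R x + q2 *\<^sub>R y + r2 *\<^sub>R z) + (p3 *\<^sub>R x + q3 *\<^sub>R y + r3 *\<^sub>R z)
      - m *\<^sub>R (p1 *\<^sub>R x + q1 *\<^sub>R y + r1 *\<^sub>R z))
    = (l * (p2 + p3 - m * p1)) *\<^sub>R x + (l * (q2 + q3 - m * q1)) *\<^sub>R y + (l * (r2 + r3 - m * r1))
        *\<^sub>R z"
  by (simp add: algebra_simps)

section \<open>The orbit of a base face on the hyperboloid\<close>

locale hyp_frame =
  fixes a b c :: vec
  assumes gram_abc: "gram a b c" and pos_abc: "fst a > 0" "fst b > 0" "fst c > 0"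
begin

abbreviation "T \<equiv> tri a b c"

definition verts :: "vec set" where "verts = {x. \<exists>y z. T x y z}"

definition adjv :: "vec \<Rightarrow> vec \<Rightarrow> bool" where "adjv x y \<longleftrightarrow> (\<exists>z. T x y z)"

lemma T_perm: "T x y z \<Longrightarrow> T y x z" "T x y z \<Longrightarrow> T x z y" "T x y z \<Longrightarrow> T z y x"
  by (blast intro: tri.intros)+

lemma T_gram: "T x y z \<Longrightarrow> gram x y z"
  using tri_gram gram_abc by blast

lemma T_verts: "T x y z \<Longrightarrow> x \<in> verts" "T x y z \<Longrightarrow> y \<in> verts" "T x y z \<Longrightarrow> z \<in> verts"
  unfolding verts_def using T_perm by blast+

lemma T_tri: "T x y z \<Longrightarrow> T x' y' z' \<Longrightarrow> tri x y z x' y' z'"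
  using tri_sym tri_trans by blast

text \<open>Cauchy-Schwarz inside the forward light cone: the spatial part of each vector is shorter
  than its time part.\<close>

lemma timelike_mform_pos:
  assumes "mform x x = 2 - lam" "mform y y = 2 - lam" "fst x > 0" "fst y > 0"
  shows "mform x y > 0"
proof -
  have l: "2 - lam > 0" using lam_bounds by simp
  have n: "(cmod (snd w))\<^sup>2 < (fst w)\<^sup>2" if "mform w w = 2 - lam" for w
  proof -
    have "(2 - lam) * ((fst w)\<^sup>2 - (cmod (snd w))\<^sup>2) = (2 - lam) * 1"
      using that[unfolded mform_def] cmod_power2[of "snd w"] by algebra
    hence "(fst w)\<^sup>2 - (cmod (snd w))\<^sup>2 = 1" using l by (metis less_irrefl mult_left_cancel)
    thus ?thesis by simp
  qed
  have "cmod (snd x) < fst x" "cmod (snd y) < fst y"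
    using n[OF assms(1)] n[OF assms(2)] assms(3,4) by (auto intro: power_less_imp_less_base)
  hence "cmod (snd x) * cmod (snd y) < fst x * fst y"
    using assms by (intro mult_strict_mono) auto
  moreover have "Re (snd x * cnj (snd y)) \<le> cmod (snd x) * cmod (snd y)"
    using complex_Re_le_cmod[of "snd x * cnj (snd y)"] by (simp add: norm_mult)
  ultimately have "fst x * fst y - Re (snd x) * Re (snd y) - Im (snd x) * Im (snd y) > 0"
    by simp
  thus ?thesis using l by (simp add: mform_def)
qed

text \<open>A flipped vertex stays on the upper sheet of the hyperboloid: on the lower one its
  product with \<open>x\<close> would be negative, but it is \<open>lam\<close>.\<close>

lemma T_fst_pos: "T x y z \<Longrightarrow> fst x > 0 \<and> fst y > 0 \<and> fst z > 0"
proof (induction rule: tri.induct)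
  case (flip x y z)
  define w where "w = lam *\<^sub>R (x + y) - z"
  have g: "mform w w = 2 - lam" "mform x w = lam" "mform x x = 2 - lam"
    using T_gram[OF tri.flip[OF flip.hyps]] unfolding gram_def w_def by blast+
  have "fst w > 0"
  proof (rule ccontr)
    assume "\<not> fst w > 0"
    moreover have "fst w \<noteq> 0"
    proof
      assume z: "fst w = 0"
      have "mform w w = (2 - lam) * - ((Re (snd w))\<^sup>2 + (Im (snd w))\<^sup>2)"
        unfolding mform_def z by (simp add: power2_eq_square algebra_simps)
      also have "\<dots> \<le> 0" using lam_bounds by (intro mult_nonneg_nonpos) auto
      finally show False using g lam_bounds by simp
    qed
    ultimately have "fst (- w) > 0" by simp
    moreover have "mform (- w) (- w) = 2 - lam" using g(1) by simp
    ultimately have "mform x (- w) > 0" using timelike_mform_pos[of x "- w"] g flip.IH by blast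
    hence "- mform x w > 0" by simp
    thus False using g lam_gt_1 by simp
  qed
  thus ?case using flip.IH unfolding w_def by blast
qed (use pos_abc in auto)

lemma verts_mform_self: "x \<in> verts \<Longrightarrow> mform x x = 2 - lam"
  unfolding verts_def using T_gram unfolding gram_def by blast

lemma verts_fst_pos: "x \<in> verts \<Longrightarrow> fst x > 0"
  unfolding verts_def using T_fst_pos by blast

lemma verts_mform_pos: "x \<in> verts \<Longrightarrow> y \<in> verts \<Longrightarrow> mform x y > 0"
  by (rule timelike_mform_pos) (simp_all add: verts_mform_self verts_fst_pos)

lemma T_abs_ge_1:
  assumes "T x y z" "v \<in> verts"
  shows "\<bar>mform (nrm x y z) v\<bar> \<ge> 1"
proof -
  obtain y' z' where "T v y' z'" using assms(2) by (auto simp: verts_def)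
  thus ?thesis by (rule tri_mform_nrm_abs_ge_1[OF T_tri[OF assms(1)] T_gram[OF assms(1)]])
qed

lemma T_span:
  assumes "T x y z" "v \<in> verts"
  obtains p q r where "v = p *\<^sub>R x + q *\<^sub>R y + r *\<^sub>R z"
proof -
  obtain y' z' where "T v y' z'" using assms(2) by (auto simp: verts_def)
  show thesis by (rule tri_span[OF T_tri[OF assms(1) \<open>T v y' z'\<close>]]) (rule that)
qed

text \<open>Both normals of every line occur in \<open>petrie\<close>.  The set is not defined as an orbit: the
bound by 1 on all vertices already characterises the normals crossing a given face.\<close>

definition petrie :: "vec set" where
  "petrie = {n. mform n n = - lam * (3 + lam) \<and> (\<forall>v\<in>verts. \<bar>mform n v\<bar> \<ge> 1) \<and> (\<exists>p q r. n
      = p *\<^sub>R a + q *\<^sub>R b + r *\<^sub>R c)}"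

lemma petrie_uminus:
  assumes "n \<in> petrie" shows "- n \<in> petrie"
proof -
  have n: "mform n n = - lam * (3 + lam)" "\<And>v. v \<in> verts \<Longrightarrow> \<bar>mform n v\<bar> \<ge> 1"
      "\<exists>p q r. n = p *\<^sub>R a + q *\<^sub>R b + r *\<^sub>R c"
    using assms by (simp_all add: petrie_def)
  obtain p q r where "n = p *\<^sub>R a + q *\<^sub>R b + r *\<^sub>R c" using n(3) by blast
  hence "- n = (- p) *\<^sub>R a + (- q) *\<^sub>R b + (- r) *\<^sub>R c" by simp
  hence "\<exists>p q r. - n = p *\<^sub>R a + q *\<^sub>R b + r *\<^sub>R c" by blast
  moreover have "mform (- n) (- n) = - lam * (3 + lam)" "\<And>v. v \<in> verts \<Longrightarrow> \<bar>mform (- n) v\<bar> \<ge> 1"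
    using n(1,2) by simp_all
  ultimately show ?thesis unfolding petrie_def by blast
qed

lemma petrie_span:
  assumes "T x y z" "n \<in> petrie"
  obtains p q r where "n = p *\<^sub>R x + q *\<^sub>R y + r *\<^sub>R z"
proof -
  have v: "a \<in> verts" "b \<in> verts" "c \<in> verts" using T_verts[OF tri.base] by auto
  obtain p1 q1 r1 where 1: "a = p1 *\<^sub>R x + q1 *\<^sub>R y + r1 *\<^sub>R z" using T_span[OF assms(1) v(1)] .
  obtain p2 q2 r2 where 2: "b = p2 *\<^sub>R x + q2 *\<^sub>R y + r2 *\<^sub>R z" using T_span[OF assms(1) v(2)] .
  obtain p3 q3 r3 where 3: "c = p3 *\<^sub>R x + q3 *\<^sub>R y + r3 *\<^sub>R z" using T_span[OF assms(1) v(3)] .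
  obtain p q r where "n = p *\<^sub>R a + q *\<^sub>R b + r *\<^sub>R c" using assms(2) by (auto simp: petrie_def)
  hence "n = p *\<^sub>R (p1 *\<^sub>R x + q1 *\<^sub>R y + r1 *\<^sub>R z) + q *\<^sub>R (p2 *\<^sub>R x + q2 *\<^sub>R y + r2 *\<^sub>R z)
      + r *\<^sub>R (p3 *\<^sub>R x + q3 *\<^sub>R y + r3 *\<^sub>R z)"
    by (simp only: 1[symmetric] 2[symmetric] 3[symmetric])
  hence "n = (p * p1 + q * p2 + r * p3) *\<^sub>R x + (p * q1 + q * q2 + r * q3) *\<^sub>R y + (p * r1 + q *
      r2 + r * r3) *\<^sub>R z"
    by (simp only: scaleR_comb)
  thus ?thesis by (rule that)
qed

lemma nrm_petrie: assumes "T x y z" shows "nrm x y z \<in> petrie"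
proof -
  obtain p1 q1 r1 where 1: "x = p1 *\<^sub>R a + q1 *\<^sub>R b + r1 *\<^sub>R c"
      using T_span[OF tri.base T_verts(1)[OF assms]] .
  obtain p2 q2 r2 where 2: "y = p2 *\<^sub>R a + q2 *\<^sub>R b + r2 *\<^sub>R c"
      using T_span[OF tri.base T_verts(2)[OF assms]] .
  obtain p3 q3 r3 where 3: "z = p3 *\<^sub>R a + q3 *\<^sub>R b + r3 *\<^sub>R c"
      using T_span[OF tri.base T_verts(3)[OF assms]] .
  have "nrm x y z = (lam * (p2 + p3 - (1 + lam) * p1)) *\<^sub>R a + (lam * (q2 + q3 - (1 + lam) * q1))
      *\<^sub>R b
     + (lam * (r2 + r3 - (1 + lam) * r1)) *\<^sub>R c"
    unfolding nrm_def by (subst 1, subst 2, subst 3, rule nrm_comb)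
  thus ?thesis unfolding petrie_def using T_abs_ge_1[OF assms] mform_nrm(4)[OF T_gram[OF assms]]
      by blast
qed

text \<open>The norm of \<open>n\<close> is a quadratic expression in its products with
  \<open>x\<close>, \<open>y\<close>, \<open>z\<close>, each at least 1 in absolute value. With the
  given signs, the norm prescribed in \<open>petrie\<close> is reached only at 1, -1, -1, and these
  products determine \<open>n\<close>.\<close>

lemma crossing_normal:
  assumes t: "T x y z" and n: "n \<in> petrie" and s: "mform n x > 0" "mform n y < 0" "mform n z < 0"
  shows "n = nrm x y z"
proof -
  obtain p q r where pqr: "n = p *\<^sub>R x + q *\<^sub>R y + r *\<^sub>R z" using petrie_span[OF t n] .
  define A D E where "A = mform n x" and "D = mform n y" and "E = mform n z"
  have g: "mform x x = 2 - lam" "mform y y = 2 - lam" "mform z z = 2 - lam" "mform x y = lam"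
      "mform x z = lam" "mform y z = lam"
    "mform y x = lam" "mform z x = lam" "mform z y = lam"
    using T_gram[OF t] by (simp_all add: gram_def mform_commute[of y x] mform_commute[of z x]
        mform_commute[of z y])
  define l where "l = lam"
  have cub: "l ^ 3 = 1 + 2 * l - l\<^sup>2" and lb: "1 < l" "l < 2"
    using lam_cubic lam_bounds by (simp_all add: l_def)
  have A: "A = (2 - l) * p + l * q + l * r" and D: "D = l * p + (2 - l) * q + l * r"
    and E: "E = l * p + l * q + (2 - l) * r"
    unfolding A_def D_def E_def pqr mform_linear g l_def by (simp_all add: algebra_simps)
  have nn: "p * A + q * D + r * E = - l * (3 + l)"
  proof -
    have "mform n n = p * A + q * D + r * E"
      unfolding A_def D_def E_def mform_commute[of n x] mform_commute[of n y] mform_commute[of n z]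
      by (subst (1) pqr) (simp add: algebra_simps)
    thus ?thesis using n by (simp add: petrie_def l_def)
  qed
  have ge: "A \<ge> 1" "- D \<ge> 1" "- E \<ge> 1"
    using n s T_verts[OF t] by (auto simp: petrie_def A_def D_def E_def)
  define P Q R where "P = A - 1" and "Q = - D - 1" and "R = - E - 1"
  have nonneg: "P \<ge> 0" "Q \<ge> 0" "R \<ge> 0" using ge by (simp_all add: P_def Q_def R_def)
  \<comment> \<open>The norm in terms of the inverse Gram matrix, cleared of denominators.\<close>
  have "(2 + l) * (A\<^sup>2 + D\<^sup>2 + E\<^sup>2) - l * (A + D + E)\<^sup>2
      = (2 - 2 * l) * (2 + l) * (p * A + q * D + r * E)"
    unfolding A D E by algebra
  also have "\<dots> = 6 + 2 * l" unfolding nn using cub by algebra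
  \<comment> \<open>Measured from the extremal values 1, -1, -1, every term is non-negative.\<close>
  finally have "4 * (1 + l) * P + 4 * (Q + R) + 2 * P\<^sup>2 + (2 - l) * (Q\<^sup>2 + R\<^sup>2) + l * (Q - R)\<^sup>2 +
      2 * l * P * (Q + R) = 0"
    unfolding P_def Q_def R_def by algebra
  moreover have "0 \<le> 2 * P\<^sup>2" "0 \<le> (2 - l) * (Q\<^sup>2 + R\<^sup>2)" "0 \<le> l * (Q - R)\<^sup>2"
      "0 \<le> 2 * l * P * (Q + R)"
    "0 \<le> 4 * (1 + l) * P"
    using nonneg lb by simp_all
  moreover have "t1 = 0 \<and> Q = 0 \<and> R = 0" if "t1 + 4 * (Q + R) + t2 + t3 + t4 + t5 = 0"
    "0 \<le> t2" "0 \<le> t3" "0 \<le> t4" "0 \<le> t5" "0 \<le> t1" for t1 t2 t3 t4 t5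
    using that nonneg by (simp add: add_nonneg_eq_0_iff)
  ultimately have "4 * (1 + l) * P = 0" "Q = 0" "R = 0" by blast+
  hence "P = 0" using lb by simp
  hence ADE: "A = 1" "D = - 1" "E = - 1" using \<open>Q = 0\<close> \<open>R = 0\<close> by (simp_all add: P_def Q_def R_def)
  have "(2 - 2 * l) * (q - r) = 0" using ADE A D E by algebra
  hence qr: "q = r" using lb by simp
  have q: "q = l" using ADE A D E cub unfolding qr by algebra
  have "l * (p + l * (1 + l)) = 0" using ADE A D E cub qr q by algebra
  hence p: "p = - l * (1 + l)" using lb by simp
  show ?thesis unfolding pqr qr[symmetric] p q nrm_def l_def by (simp add: algebra_simps)
qed

section \<open>Counting separating Petrie lines\<close>

text \<open>A line has two normals \<open>n\<close> and \<open>- n\<close>; the signs select one, so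
  that each line separating \<open>x\<close> from \<open>y\<close> counts once.\<close>

definition sep :: "vec \<Rightarrow> vec \<Rightarrow> vec set" where
  "sep x y = {n \<in> petrie. mform n x > 0 \<and> mform n y < 0}"

lemma petrie_nonzero: "n \<in> petrie \<Longrightarrow> v \<in> verts \<Longrightarrow> mform n v \<noteq> 0"
  by (fastforce simp: petrie_def)

text \<open>By \<open>crossing_normal\<close> the signs on the face determine the normal; the two
  elements differ in whether \<open>z\<close> lies on the side of \<open>y\<close> or of
  \<open>x\<close>.\<close>

lemma sep_edge:
  assumes t: "T x y z"
  shows "sep x y = {nrm x y z, - nrm y x z}" "nrm x y z \<noteq> - nrm y x z"
proof -
  note b = mform_nrm[OF T_gram[OF t]] and b' = mform_nrm[OF T_gram[OF T_perm(1)[OF t]]]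
  show "nrm x y z \<noteq> - nrm y x z"
  proof
    assume "nrm x y z = - nrm y x z"
    hence "mform (nrm x y z) z = - mform (nrm y x z) z" by simp
    thus False using b b' by simp
  qed
  show "sep x y = {nrm x y z, - nrm y x z}"
  proof (intro equalityI subsetI)
    fix n assume "n \<in> sep x y"
    hence n: "n \<in> petrie" "mform n x > 0" "mform n y < 0" by (auto simp: sep_def)
    show "n \<in> {nrm x y z, - nrm y x z}"
    proof (cases "mform n z < 0")
      case True
      thus ?thesis using crossing_normal[OF t n] by simp
    next
      case False
      hence "mform n z > 0" using petrie_nonzero[OF n(1) T_verts(3)[OF t]] by simp
      hence "- n = nrm y x z"
        using crossing_normal[OF T_perm(1)[OF t] petrie_uminus[OF n(1)]] n by simp
      hence "n = - nrm y x z" by (metis minus_minus)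
      thus ?thesis by simp
    qed
  next
    fix n assume "n \<in> {nrm x y z, - nrm y x z}"
    thus "n \<in> sep x y"
      using b b' nrm_petrie[OF t] petrie_uminus[OF nrm_petrie[OF T_perm(1)[OF t]]]
          by (auto simp: sep_def)
  qed
qed

lemma adjv_verts: "adjv x y \<Longrightarrow> x \<in> verts" "adjv x y \<Longrightarrow> y \<in> verts"
  unfolding adjv_def using T_verts by blast+

lemma adjv_irrefl: "\<not> adjv x x"
proof
  assume "adjv x x"
  then obtain z where "T x x z" unfolding adjv_def by blast
  hence "2 - lam = lam" using T_gram unfolding gram_def by metis
  thus False using lam_gt_1 by simp
qed

lemma sep_self: "sep x x = {}"
  by (auto simp: sep_def)

lemma sep_triangle: "y \<in> verts \<Longrightarrow> sep x z \<subseteq> sep x y \<union> sep y z"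
  using petrie_nonzero by (fastforce simp: sep_def)

lemma finite_sep_edge: "T x y z \<Longrightarrow> finite (sep x y)"
  using sep_edge(1) by simp

text \<open>Induction along a chain of flips from a face at \<open>x\<close> to a face at
  \<open>y\<close>: each new vertex is joined to an old one by an edge, and only two lines cross an
  edge.\<close>

lemma finite_sep:
  assumes "x \<in> verts" "y \<in> verts"
  shows "finite (sep x y)"
proof -
  obtain y' z' where x: "T x y' z'" using assms(1) by (auto simp: verts_def)
  obtain y'' z'' where y: "T y y'' z''" using assms(2) by (auto simp: verts_def)
  have "finite (sep x u) \<and> finite (sep x v) \<and> finite (sep x w) \<and> T u v w" if "tri x y' z' u v w"
      for u v w
    using that
  proof induction
    case base
    show ?case using finite_sep_edge[OF x] finite_sep_edge[OF T_perm(2)[OF x]] x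
        by (simp add: sep_self)
  next
    case (swap12 u v w)
    thus ?case using T_perm(1)[of u v w] by blast
  next
    case (swap23 u v w)
    thus ?case using T_perm(2)[of u v w] by blast
  next
    case (flip u v w)
    let ?w = "lam *\<^sub>R (u + v) - w"
    have t: "T u v ?w" using flip.IH tri.flip[of a b c u v w] by blast
    have "finite (sep u ?w)" by (rule finite_sep_edge[OF T_perm(2)[OF t]])
    hence "finite (sep x ?w)"
      using flip.IH sep_triangle[OF T_verts(1)[OF t], of x ?w] by (meson finite_UnI finite_subset)
    thus ?case using flip.IH t by blast
  qed
  from this[OF T_tri[OF x y]] show ?thesis by blast
qed

definition sep_count :: "vec \<Rightarrow> vec \<Rightarrow> nat" where "sep_count x y = card (sep x y)"

lemma sep_count_self [simp]: "sep_count x x = 0"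
  by (simp add: sep_count_def sep_self)

definition sg :: "real \<Rightarrow> int" where "sg r = (if r > 0 then 1 else - 1)"

text \<open>Only the two lines crossing the edge \<open>vu\<close> change their status: such a line
  starts to separate when \<open>x\<close> is on the side of \<open>v\<close>, and ceases to do so
  when \<open>x\<close> is on the side of \<open>u\<close>.\<close>

lemma sep_count_edge_diff:
  assumes t: "T v u w" and o: "x \<in> verts"
  shows "int (sep_count x u) = int (sep_count x v) + sg (mform (nrm v u w) x) + sg (mform (- nrm u
      v w) x)"
proof -
  define n1 n2 where "n1 = nrm v u w" and "n2 = - nrm u v w"
  have S: "sep v u = {n1, n2}" "n1 \<noteq> n2" using sep_edge[OF t] by (simp_all add: n1_def n2_def)
  have verts: "v \<in> verts" "u \<in> verts" using T_verts[OF t] by blast+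
  define M where "M = {n \<in> petrie. mform n x > 0 \<and> mform n v < 0 \<and> mform n u < 0}"
  \<comment> \<open>The lines lost on the way from \<open>v\<close> to \<open>u\<close>; a normal in
    \<open>sep x v\<close> is negative at \<open>v\<close>, hence the change of sign.\<close>
  define X where "X = uminus ` {n \<in> {n1, n2}. mform n x < 0}"
  define Y where "Y = {n \<in> {n1, n2}. mform n x > 0}"
  have N12: "n1 \<in> petrie" "n2 \<in> petrie" using S unfolding sep_def by blast+
  have Xeq: "X = {n \<in> petrie. mform n x > 0 \<and> mform n v < 0 \<and> mform n u > 0}"
  proof (intro equalityI subsetI)
    fix n assume "n \<in> X"
    then obtain k where k: "k \<in> sep v u" "mform k x < 0" "n = - k" unfolding X_def S by blast
    thus "n \<in> {n \<in> petrie. mform n x > 0 \<and> mform n v < 0 \<and> mform n u > 0}"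
      using petrie_uminus unfolding sep_def by simp
  next
    fix n assume n: "n \<in> {n \<in> petrie. mform n x > 0 \<and> mform n v < 0 \<and> mform n u > 0}"
    hence "- n \<in> sep v u" unfolding sep_def using petrie_uminus by simp
    moreover have "mform (- n) x < 0" using n by simp
    ultimately show "n \<in> X" unfolding X_def S by (intro image_eqI[of _ _ "- n"]) auto
  qed
  have nz: "mform n v < 0 \<or> mform n v > 0" "mform n u < 0 \<or> mform n u > 0" if "n \<in> petrie" for n
    using petrie_nonzero[OF that] verts by (simp_all add: neq_iff[symmetric])
  have "sep x v = M \<union> X" unfolding Xeq M_def sep_def using nz by blast
  moreover have "sep x u = M \<union> Y"
  proof -
    have "Y = {n \<in> sep v u. mform n x > 0}" unfolding Y_def S ..
    thus ?thesis unfolding M_def sep_def using nz by blast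
  qed
  moreover have "M \<inter> X = {}" "M \<inter> Y = {}"
  proof -
    show "M \<inter> X = {}" unfolding Xeq M_def by auto
    have "Y \<subseteq> sep v u" unfolding Y_def S by blast
    thus "M \<inter> Y = {}" unfolding M_def sep_def by fastforce
  qed
  moreover have "finite M" using finite_subset[OF _ finite_sep[OF o verts(1)], of M]
      by (auto simp: M_def sep_def)
  moreover have "finite X" "finite Y" by (simp_all add: X_def Y_def)
  ultimately have "int (sep_count x u) + int (card X) = int (sep_count x v) + int (card Y)"
    unfolding sep_count_def by (simp add: card_Un_disjoint)
  moreover have "int (card Y) - int (card X) = sg (mform n1 x) + sg (mform n2 x)"
  proof -
    have cX: "card X = card {n \<in> {n1, n2}. mform n x < 0}" unfolding X_def
        by (rule card_image) (simp add: inj_on_def)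
    have nz: "mform n1 x \<noteq> 0" "mform n2 x \<noteq> 0" using petrie_nonzero N12 o by blast+
    have e: "{n \<in> {n1, n2}. P n} = (if P n1 then {n1} else {}) \<union> (if P n2 then {n2} else {})"
        for P by auto
    show ?thesis unfolding cX Y_def e using nz S(2) by (auto simp: sg_def)
  qed
  ultimately show ?thesis unfolding n1_def n2_def by simp
qed

lemma sep_count_step: assumes "adjv v u" "x \<in> verts" shows
    "int (sep_count x u) \<le> int (sep_count x v) + 2"
proof -
  obtain w where "T v u w" using assms(1) unfolding adjv_def by blast
  from sep_count_edge_diff[OF this assms(2)] show ?thesis by (auto simp: sg_def split: if_splits)
qed

section \<open>The seven lines around a vertex\<close>

lemma T_fan: "T v y z \<Longrightarrow> T v (fan v y z i) (fan v y z (i + 1))"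
proof (induction i)
  case (Suc i)
  have "T v (fan v y z (i + 1)) (lam *\<^sub>R (v + fan v y z (i + 1)) - fan v y z i)"
    using tri.flip[OF T_perm(2)[OF Suc.IH[OF Suc.prems]]] .
  thus ?case by simp
qed simp

definition side_normal :: "vec \<Rightarrow> vec \<Rightarrow> vec \<Rightarrow> nat \<Rightarrow> vec" where
  "side_normal v y z i = nrm v (fan v y z i) (fan v y z (i + 1))"

lemma side_normal_period: "side_normal v y z (i + 7) = side_normal v y z i"
  using fan_period[of v y z i] fan_period[of v y z "i + 1"]
      by (simp add: side_normal_def add.commute add.left_commute)

lemma side_normal_eq: "side_normal v y z i = - nrm (fan v y z (i + 1)) v (fan v y z (i + 2))"
  using nrm_flip[of "fan v y z (i + 1)" v "fan v y z i"]
  unfolding side_normal_def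
  by (simp add: nrm_def algebra_simps)

text \<open>Lines \<open>i\<close> and \<open>i + 1\<close> are the two crossing the edge from
  \<open>v\<close> to neighbour \<open>i + 1\<close>; by \<open>side_normal_eq\<close>, line
  \<open>i\<close> is the second normal of that edge.\<close>

lemma sep_count_fan:
  assumes t: "T v y z" and o: "x \<in> verts"
  shows "int (sep_count x (fan v y z (i + 1)))
      = int (sep_count x v) + sg (mform (side_normal v y z i) x) + sg (mform (side_normal v y z (i
          + 1)) x)"
  using sep_count_edge_diff[OF T_fan[OF t, of "i + 1"] o] unfolding side_normal_eq[of v y z i]
      unfolding side_normal_def
  by simp

lemma side_normal_sum_pos:
  assumes t: "T v y z" and o: "x \<in> verts"
  shows "mform (side_normal v y z i) x + mform (side_normal v y z (i + 3)) x > 0"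
proof -
  have "mform (side_normal v y z i) x + mform (side_normal v y z (i + 3)) x
      = mform (v + fan v y z (i + 2)) x"
    using nrm_fan_sum[of v y z i] unfolding side_normal_def
    by (metis mform_linear(1) add.assoc numeral_plus_one semiring_norm(2) semiring_norm(4)
        semiring_norm(8))
  also have "\<dots> > 0"
    unfolding mform_linear
    by (intro add_pos_pos verts_mform_pos[OF _ o] T_verts(1)[OF t] T_verts(1)[OF T_perm(1)[OF
        T_fan[OF t]]])
  finally show ?thesis .
qed

lemma side_normal_abs_ge_1: "T v y z \<Longrightarrow> x \<in> verts \<Longrightarrow> \<bar>mform (side_normal v y z i) x\<bar> \<ge> 1"
  unfolding side_normal_def by (rule T_abs_ge_1[OF T_fan])

text \<open>By the next two lemmas, the vertex \<open>x\<close> is neither in the cell of \<open>v\<close> nor in the medial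
triangle of a face: these are the regions beyond no, respectively beyond exactly one, of the seven
lines around \<open>v\<close>.\<close>

lemma all_inside_imp_eq:
  assumes t: "T v y z" and o: "x \<in> verts"
    and h: "mform (nrm v y z) x \<ge> 1" "mform (nrm v y z) x \<le> - mform (nrm y v z) x"
        "mform (nrm v y z) x \<le> - mform (nrm z v y) x"
  shows "x = v"
proof -
  obtain p q r where x: "x = p *\<^sub>R v + q *\<^sub>R y + r *\<^sub>R z" using T_span[OF t o] .
  note n = mform_nrm[OF T_gram[OF t]] mform_nrm[OF T_gram[OF T_perm(1)[OF t]]]
    mform_nrm[OF T_gram[OF T_perm(1)[OF T_perm(2)[OF t]]]]
  have 1: "mform (nrm v y z) x = p - q - r" "mform (nrm y v z) x = q - p - r"
      "mform (nrm z v y) x = r - p - q"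
    by (simp_all add: x n)
  have g: "mform v v = 2 - lam" "mform y y = 2 - lam" "mform z z = 2 - lam" "mform v y = lam"
      "mform v z = lam" "mform y z = lam"
    "mform y v = lam" "mform z v = lam" "mform z y = lam"
    using T_gram[OF t] by (simp_all add: gram_def mform_commute[of y v] mform_commute[of z v]
        mform_commute[of z y])
  have pq: "p \<ge> 1 + q + r" "q \<ge> 0" "r \<ge> 0" using h unfolding 1 by linarith+
  have "2 - lam = mform x x" using verts_mform_self[OF o] by simp
  also have "\<dots> = (2 - lam) * (p\<^sup>2 + q\<^sup>2 + r\<^sup>2) + 2 * lam * (p * (q + r) + q * r)"
    unfolding x mform_linear g by (simp add: algebra_simps power2_eq_square)
  finally have e: "(2 - lam) * (p\<^sup>2 - 1) + (2 - lam) * (q\<^sup>2 + r\<^sup>2) + 2 * lam * (p * (q + r) + q *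
      r) = 0"
    by (simp add: algebra_simps)
  have lb: "lam > 1" "lam < 2" using lam_bounds by simp_all
  have "p\<^sup>2 \<ge> 1" using pq by (simp add: one_le_power)
  hence "(2 - lam) * (p\<^sup>2 - 1) \<ge> 0" "(2 - lam) * (q\<^sup>2 + r\<^sup>2) \<ge> 0"
      "2 * lam * (p * (q + r) + q * r) \<ge> 0"
    using lb pq by simp_all
  hence "(2 - lam) * (p\<^sup>2 - 1) = 0" "(2 - lam) * (q\<^sup>2 + r\<^sup>2) = 0" using e
      by (simp_all add: add_nonneg_eq_0_iff)
  hence "p\<^sup>2 = 1" "q = 0" "r = 0" using lb by (simp_all add: sum_power2_eq_zero_iff)
  moreover have "p = 1" using \<open>p\<^sup>2 = 1\<close> pq by (simp add: power2_eq_1_iff)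
  ultimately show ?thesis by (simp add: x)
qed

lemma not_medial:
  assumes t: "T v y z" and o: "x \<in> verts"
    and h: "mform (nrm v y z) x \<le> - 1" "mform (nrm y v z) x \<le> - 1" "mform (nrm z v y) x \<le> - 1"
  shows False
proof -
  obtain p q r where x: "x = p *\<^sub>R v + q *\<^sub>R y + r *\<^sub>R z" using T_span[OF t o] .
  note n = mform_nrm[OF T_gram[OF t]] mform_nrm[OF T_gram[OF T_perm(1)[OF t]]]
    mform_nrm[OF T_gram[OF T_perm(1)[OF T_perm(2)[OF t]]]]
  have 1: "mform (nrm v y z) x = p - q - r" "mform (nrm y v z) x = q - p - r"
      "mform (nrm z v y) x = r - p - q"
    by (simp_all add: x n)
  have g: "mform v v = 2 - lam" "mform y y = 2 - lam" "mform z z = 2 - lam" "mform v y = lam"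
      "mform v z = lam" "mform y z = lam"
    "mform y v = lam" "mform z v = lam" "mform z y = lam"
    using T_gram[OF t] by (simp_all add: gram_def mform_commute[of y v] mform_commute[of z v]
        mform_commute[of z y])
  have pq: "p \<ge> 1" "q \<ge> 1" "r \<ge> 1" using h unfolding 1 by linarith+
  have lb: "lam > 1" "lam < 2" using lam_bounds by simp_all
  have "2 - lam = mform x x" using verts_mform_self[OF o] by simp
  also have "\<dots> = (2 - lam) * (p\<^sup>2 + q\<^sup>2 + r\<^sup>2) + 2 * lam * (p * (q + r) + q * r)"
    unfolding x mform_linear g by (simp add: algebra_simps power2_eq_square)
  finally have "2 - lam = (2 - lam) * (p\<^sup>2 + q\<^sup>2 + r\<^sup>2) + 2 * lam * (p * (q + r) + q * r)" .
  moreover have "(2 - lam) * (p\<^sup>2 + q\<^sup>2 + r\<^sup>2) \<ge> (2 - lam) * 1"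
    using lb pq by (intro mult_left_mono) (auto intro: order_trans[OF one_le_power[of p 2]])
  moreover have "2 * lam * (p * (q + r) + q * r) > 0" using lb pq
      by (intro mult_pos_pos add_pos_pos) auto
  moreover have False if "s = t1 + t2" "s * 1 \<le> t1" "0 < t2" for s t1 t2 :: real
    using that by simp
  ultimately show False by blast
qed

text \<open>Take the line \<open>k\<close> with the smallest product. If \<open>x\<close> were not
  beyond it, \<open>all_inside_imp_eq\<close> would give \<open>x = v\<close>; if \<open>x\<close>
  were beyond it but beyond neither adjacent line, \<open>not_medial\<close> would be violated in
  the face at this corner.\<close>

lemma two_sides_negative:
  assumes t: "T v y z" and o: "x \<in> verts" and ne: "x \<noteq> v"
  shows "\<exists>i<7. mform (side_normal v y z i) x < 0 \<and> mform (side_normal v y z (i + 1)) x < 0"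
proof -
  define b where "b i = mform (side_normal v y z i) x" for i
  have per: "b (i + 7) = b i" for i by (simp add: b_def side_normal_period)
  have big: "b i \<ge> 1 \<or> b i \<le> - 1" for i using side_normal_abs_ge_1[OF t o, of i] unfolding b_def
      by linarith
  have bmod: "b i = b (i mod 7)" for i
  proof -
    have "b (k + 7 * j) = b k" for j k
      by (induction j) (use per[of "k + 7 * _"] in \<open>simp_all add: algebra_simps\<close>)
    from this[of "i mod 7" "i div 7"] show ?thesis by simp
  qed
  define k where "k = arg_min_on b {..<7::nat}"
  have k: "k < 7" "\<And>i. i < 7 \<Longrightarrow> b k \<le> b i"
    using arg_min_if_finite(1)[of "{..<7}" b] arg_min_least[of "{..<7}" _ b]
    by (auto simp: k_def lessThan_empty_iff)
  have kmin: "b k \<le> b i" for i using k(2)[of "i mod 7"] bmod[of i] by simp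
  \<comment> \<open>\<open>k + 6\<close> stands for \<open>k - 1\<close> modulo 7, so that the
    chosen line has the middle index \<open>j + 1\<close>.\<close>
  define j where "j = k + 6"
  have bj: "b (j + 1) = b k" using per[of k] by (simp add: j_def add.commute)
  have tj: "T v (fan v y z (j + 1)) (fan v y z (j + 2))" using T_fan[OF t, of "j + 1"] by simp
  have s1: "side_normal v y z (j + 1) = nrm v (fan v y z (j + 1)) (fan v y z (j + 2))"
    by (simp add: side_normal_def)
  have s0: "side_normal v y z j = - nrm (fan v y z (j + 1)) v (fan v y z (j + 2))"
      by (rule side_normal_eq)
  have s2: "side_normal v y z (j + 2) = - nrm (fan v y z (j + 2)) v (fan v y z (j + 1))"
    unfolding side_normal_def by (simp add: nrm_def algebra_simps)
  have "b j \<le> - 1 \<or> b (j + 2) \<le> - 1" and neg: "b (j + 1) \<le> - 1"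
  proof -
    show neg: "b (j + 1) \<le> - 1"
    proof (rule ccontr)
      assume "\<not> b (j + 1) \<le> - 1"
      hence "b (j + 1) \<ge> 1" using big by blast
      moreover have "b (j + 1) \<le> b j" "b (j + 1) \<le> b (j + 2)" unfolding bj by (rule kmin)+
      ultimately have "x = v"
        using all_inside_imp_eq[OF tj o] unfolding b_def s0 s1 s2 by simp
      thus False using ne by simp
    qed
    show "b j \<le> - 1 \<or> b (j + 2) \<le> - 1"
    proof (rule ccontr)
      assume "\<not> (b j \<le> - 1 \<or> b (j + 2) \<le> - 1)"
      hence "b j \<ge> 1" "b (j + 2) \<ge> 1" using big by blast+
      thus False using not_medial[OF tj o] neg unfolding b_def s0 s1 s2 by simp
    qed
  qed
  then obtain i where "b i < 0" "b (i + 1) < 0"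
    by (metis add.assoc le_less_trans neg_less_0_iff_less one_add_one zero_less_one)
  hence "b (i mod 7) < 0 \<and> b (i mod 7 + 1) < 0"
    using bmod[of i] bmod[of "i + 1"] bmod[of "i mod 7 + 1"] by (simp add: mod_simps)
  thus ?thesis unfolding b_def by (intro exI[of _ "i mod 7"]) simp
qed

section \<open>Descent, regularity and subharmonicity\<close>

lemma sep_count_eq_0_imp_eq:
  assumes "x \<in> verts" "v \<in> verts" "sep_count x v = 0"
  shows "x = v"
proof (rule ccontr)
  assume ne: "x \<noteq> v"
  obtain y z where t: "T v y z" using assms(2) by (auto simp: verts_def)
  obtain i where i: "mform (side_normal v y z i) x < 0" using two_sides_negative[OF t assms(1) ne]
      by blast
  have "- side_normal v y z i \<in> sep x v"
    using i petrie_uminus[OF nrm_petrie[OF T_fan[OF t, of i]]] mform_nrm(1)[OF T_gram[OF T_fan[OF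
        t, of i]]]
    by (simp add: sep_def side_normal_def)
  thus False using assms finite_sep[OF assms(1,2)] by (auto simp: sep_count_def)
qed

text \<open>If \<open>x\<close> lies beyond two consecutive lines, stepping along the edge that both
  cross removes both from the count.\<close>

lemma sep_count_descent:
  assumes "x \<in> verts" "v \<in> verts" "x \<noteq> v"
  shows "\<exists>u. adjv v u \<and> int (sep_count x u) = int (sep_count x v) - 2"
proof -
  obtain y z where t: "T v y z" using assms(2) by (auto simp: verts_def)
  obtain i where i: "mform (side_normal v y z i) x < 0" "mform (side_normal v y z (i + 1)) x < 0"
    using two_sides_negative[OF t assms(1,3)] by blast
  have "adjv v (fan v y z (i + 1))" using T_fan[OF t, of "i + 1"] unfolding adjv_def by blast
  moreover have "int (sep_count x (fan v y z (i + 1))) = int (sep_count x v) - 2"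
    using sep_count_fan[OF t assms(1), of i] i by (simp add: sg_def)
  ultimately show ?thesis by blast
qed

text \<open>Neighbours at cyclic distance 1, 2, 3 have product \<open>lam\<close>,
  \<open>2 * lam\<^sup>2 + lam - 2\<close>, \<open>2 + lam\<close>, never the norm
  \<open>2 - lam\<close>; periodicity covers distances 4 to 6.\<close>

lemma fan_neq:
  assumes t: "T v y z" and ij: "i < j" "j < i + 7"
  shows "fan v y z i \<noteq> fan v y z j"
proof -
  let ?f = "fan v y z"
  have s: "mform (?f k) (?f k) = 2 - lam" "mform v (?f k) = lam" "mform (?f k) v = lam"
      "mform (?f k) (?f (k + 1)) = lam" for k
    using T_gram[OF T_fan[OF t, of k]] unfolding gram_def
    by (simp_all add: mform_commute[of "?f k" v])
  have f: "?f (k + 2) = lam *\<^sub>R (v + ?f (k + 1)) - ?f k" for k by simp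
  have 2: "mform (?f k) (?f (k + 2)) = 2 * lam\<^sup>2 + lam - 2" for k
    unfolding f mform_linear s by (simp add: algebra_simps power2_eq_square)
  have 3: "mform (?f k) (?f (k + 3)) = 2 + lam" for k
  proof -
    have "?f (k + 3) = lam *\<^sub>R (v + ?f (k + 2)) - ?f (k + 1)" using f[of "k + 1"]
        by (simp add: numeral_eq_Suc)
    hence "mform (?f k) (?f (k + 3)) = lam * (lam + (2 * lam\<^sup>2 + lam - 2)) - lam"
      by (simp only: mform_linear s 2)
    thus ?thesis using lam_cubic by algebra
  qed
  have "lam\<^sup>2 > 1" using lam_gt_1 by (simp add: one_less_power)
  hence ne: "lam \<noteq> 2 - lam" "2 * lam\<^sup>2 + lam - 2 \<noteq> 2 - lam" "2 + lam \<noteq> 2 - lam"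
    using lam_gt_1 by linarith+
  have near: "?f k \<noteq> ?f (k + d)" if "d \<in> {1, 2, 3}" for k d
  proof
    assume "?f k = ?f (k + d)"
    hence "mform (?f k) (?f (k + d)) = 2 - lam" using s(1) by simp
    moreover have "d = 1 \<or> d = 2 \<or> d = 3" using that by blast
    ultimately show False using ne
      by (elim disjE; metis 2 3 s(4))
  qed
  show ?thesis
  proof (cases "j - i \<le> 3")
    case True
    hence "j - i \<in> {1, 2, 3}" using ij by auto
    thus ?thesis using near[of "j - i" i] ij by simp
  next
    case False
    hence "i + 7 - j \<in> {1, 2, 3}" using ij by auto
    thus ?thesis using near[of "i + 7 - j" j] ij fan_period[of v y z i] by simp
  qed
qed

text \<open>A neighbour \<open>u\<close> is separated from \<open>v\<close> by exactly two lines.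
  Descending from \<open>v\<close> towards \<open>u\<close> reaches a member of the fan that no line
  separates from \<open>u\<close>, which is therefore \<open>u\<close> itself.\<close>

lemma neighbours_fan:
  assumes t: "T v y z"
  shows "{u. adjv v u} = (\<lambda>i. fan v y z (i + 1)) ` {..<7}"
proof (intro equalityI subsetI)
  fix u assume "u \<in> {u. adjv v u}"
  then obtain w where w: "T v u w" by (auto simp: adjv_def)
  have verts: "u \<in> verts" "v \<in> verts" using T_verts[OF w] by auto
  have "u \<noteq> v" using adjv_irrefl[of v] w unfolding adjv_def by blast
  then obtain i where i: "i < 7" "mform (side_normal v y z i) u < 0"
      "mform (side_normal v y z (i + 1)) u < 0"
    using two_sides_negative[OF t verts(1)] by blast
  have "sep_count u v = 2" using sep_edge[OF T_perm(1)[OF w]] by (simp add: sep_count_def)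
  hence "sep_count u (fan v y z (i + 1)) = 0" using sep_count_fan[OF t verts(1), of i] i
      by (simp add: sg_def)
  hence "u = fan v y z (i + 1)"
    by (rule sep_count_eq_0_imp_eq[OF verts(1) T_verts(2)[OF T_fan[OF t, of "i + 1"]]])
  thus "u \<in> (\<lambda>i. fan v y z (i + 1)) ` {..<7}" using i(1) by blast
next
  fix u assume "u \<in> (\<lambda>i. fan v y z (i + 1)) ` {..<7}"
  then obtain i where "u = fan v y z (i + 1)" by blast
  thus "u \<in> {u. adjv v u}" using T_fan[OF t, of "i + 1"] unfolding adjv_def by blast
qed

lemma inj_fan: "T v y z \<Longrightarrow> inj_on (\<lambda>i. fan v y z (i + 1)) {..<7}"
proof (rule inj_onI, rule ccontr)
  fix i j :: nat
  assume t: "T v y z" and h: "i \<in> {..<7}" "j \<in> {..<7}" "fan v y z (i + 1) = fan v y z (j + 1)"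
      "i \<noteq> j"
  show False
  proof (cases "i < j")
    case True
    thus ?thesis using fan_neq[OF t, of "i + 1" "j + 1"] h by simp
  next
    case False
    thus ?thesis using fan_neq[OF t, of "j + 1" "i + 1"] h by simp
  qed
qed

lemma card_neighbours:
  assumes "v \<in> verts"
  shows "card {u. adjv v u} = 7"
proof -
  obtain y z where t: "T v y z" using assms by (auto simp: verts_def)
  show ?thesis unfolding neighbours_fan[OF t] card_image[OF inj_fan[OF t]] by simp
qed

text \<open>Each of the seven lines crosses two consecutive edges at \<open>v\<close>, so the sum is
  twice the sum of their signs. The seven pairs at cyclic distance three contain every sign twice,
  so the sum of signs is not negative; being odd, it is at least 1.\<close>

lemma sep_count_subharmonic:
  assumes "v \<in> verts" "x \<in> verts"
  shows "(\<Sum>u | adjv v u. int (sep_count x u) - int (sep_count x v)) \<ge> 2"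
proof -
  obtain y z where t: "T v y z" using assms(1) by (auto simp: verts_def)
  define s where "s i = sg (mform (side_normal v y z i) x)" for i
  have "(\<Sum>u | adjv v u. int (sep_count x u) - int (sep_count x v)) = (\<Sum>i<7. s i + s (i + 1))"
    unfolding neighbours_fan[OF t] sum.reindex[OF inj_fan[OF t]] o_def
  proof (rule sum.cong[OF refl])
    fix i
    show "int (sep_count x (fan v y z (i + 1))) - int (sep_count x v) = s i + s (i + 1)"
      using sep_count_fan[OF t assms(2), of i] unfolding s_def by linarith
  qed
  also have "\<dots> = 2 * (s 0 + s 1 + s 2 + s 3 + s 4 + s 5 + s 6)"
    using side_normal_period[of v y z 0] by (simp add: eval_nat_numeral s_def)
  finally have sum: "(\<Sum>u | adjv v u. int (sep_count x u) - int (sep_count x v))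
      = 2 * (s 0 + s 1 + s 2 + s 3 + s 4 + s 5 + s 6)" .
  have pair: "s i + s (i + 3) \<ge> 0" for i
    using side_normal_sum_pos[OF t assms(2), of i] by (auto simp: s_def sg_def)
  have per: "s (i + 7) = s i" for i by (simp add: s_def side_normal_period)
  have "s 0 + s 3 \<ge> 0" "s 1 + s 4 \<ge> 0" "s 2 + s 5 \<ge> 0" "s 3 + s 6 \<ge> 0" "s 4 + s 0 \<ge> 0"
      "s 5 + s 1 \<ge> 0" "s 6 + s 2 \<ge> 0"
    using pair[of 0] pair[of 1] pair[of 2] pair[of 3] pair[of 4] pair[of 5] pair[of 6] per[of 0]
        per[of 1] per[of 2]
    by simp_all
  moreover have "s i = 1 \<or> s i = - 1" for i by (simp add: s_def sg_def)
  hence "odd (s i)" for i by (metis even_minus odd_one)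
  hence "odd (s 0 + s 1 + s 2 + s 3 + s 4 + s 5 + s 6)" by simp
  hence "s 0 + s 1 + s 2 + s 3 + s 4 + s 5 + s 6 \<noteq> 0" by (metis even_zero)
  moreover have "0 \<le> s 0 + s 1 + s 2 + s 3 + s 4 + s 5 + s 6" using calculation(1-7) by presburger
  ultimately show ?thesis unfolding sum by simp
qed

end

section \<open>The disk model\<close>

definition disk :: "complex set" where "disk = {z. cmod z < 1}"

text \<open>Inverse stereographic projection from the Poincare disk to the hyperboloid.\<close>

definition hyp :: "complex \<Rightarrow> vec" where
  "hyp z = (1 / (1 - (cmod z)\<^sup>2)) *\<^sub>R (1 + (cmod z)\<^sup>2, 2 * z)"

lemma disk_cmod2: "z \<in> disk \<Longrightarrow> (cmod z)\<^sup>2 < 1"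
  using power_strict_mono[of "cmod z" 1 2] by (simp add: disk_def)

lemma hyp_inj:
  assumes "z \<in> disk" "w \<in> disk" "hyp z = hyp w"
  shows "z = w"
proof -
  have z: "1 - (cmod z)\<^sup>2 > 0" and w: "1 - (cmod w)\<^sup>2 > 0" using assms disk_cmod2 by force+
  have 1: "(1 + (cmod z)\<^sup>2) / (1 - (cmod z)\<^sup>2) = (1 + (cmod w)\<^sup>2) / (1 - (cmod w)\<^sup>2)"
    and 2: "(1 / (1 - (cmod z)\<^sup>2)) *\<^sub>R (2 * z) = (1 / (1 - (cmod w)\<^sup>2)) *\<^sub>R (2 * w)"
    using assms(3) by (simp_all add: hyp_def)
  have "(cmod z)\<^sup>2 = (cmod w)\<^sup>2" using 1 z w by (simp add: field_simps)
  thus ?thesis using 2 w by simp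
qed

text \<open>Inversion in the circle around \<open>c\<close> that is orthogonal to the unit circle, hence has squared
radius \<open>\<bar>c\<bar>\<^sup>2 - 1\<close>.\<close>

definition circle_inv :: "complex \<Rightarrow> complex \<Rightarrow> complex" where
  "circle_inv c z = (c * cnj z - 1) / (cnj z - cnj c)"

text \<open>The Minkowski reflection along \<open>(1, c)\<close>, a vector of unscaled norm
  \<open>1 - (cmod c)\<^sup>2\<close>, spacelike for \<open>cmod c > 1\<close>.\<close>

definition vrefl :: "complex \<Rightarrow> vec \<Rightarrow> vec" where
  "vrefl c x = x + (2 * (fst x - Re (snd x) * Re c - Im (snd x) * Im c) / ((cmod c)\<^sup>2 - 1)) *\<^sub>R
      (1, c)"

lemma vrefl_linear: "vrefl c (r *\<^sub>R (x + y) - z) = r *\<^sub>R (vrefl c x + vrefl c y) - vrefl c z"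
  by (rule vec_eqI) (simp_all add: vrefl_def divide_inverse algebra_simps)

lemma circle_inv_cmod2:
  assumes "z \<in> disk" "cmod c > 1"
  shows "cnj z - cnj c \<noteq> 0"
    and "1 - (cmod (circle_inv c z))\<^sup>2 = ((cmod c)\<^sup>2 - 1) * (1 - (cmod z)\<^sup>2) / (cmod (z - c))\<^sup>2"
    and "1 + (cmod (circle_inv c z))\<^sup>2 = (((cmod c)\<^sup>2 + 1) * (1 + (cmod z)\<^sup>2) - 4 * (Re z * Re c +
        Im z * Im c)) / (cmod (z - c))\<^sup>2"
proof -
  have "z \<noteq> c" using assms by (auto simp: disk_def)
  thus nz: "cnj z - cnj c \<noteq> 0" by (metis complex_cnj_cancel_iff eq_iff_diff_eq_0)
  have d: "(cmod (z - c))\<^sup>2 > 0" using \<open>z \<noteq> c\<close> by simp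
  have "cnj z - cnj c = cnj (z - c)" by simp
  hence m: "(cmod (circle_inv c z))\<^sup>2 = (cmod (c * cnj z - 1))\<^sup>2 / (cmod (z - c))\<^sup>2"
    unfolding circle_inv_def by (simp add: norm_divide power_divide del: complex_cnj_diff)
  show "1 - (cmod (circle_inv c z))\<^sup>2 = ((cmod c)\<^sup>2 - 1) * (1 - (cmod z)\<^sup>2) / (cmod (z - c))\<^sup>2"
    and "1 + (cmod (circle_inv c z))\<^sup>2 = (((cmod c)\<^sup>2 + 1) * (1 + (cmod z)\<^sup>2) - 4 * (Re z * Re c +
        Im z * Im c)) / (cmod (z - c))\<^sup>2"
  proof -
    have N: "(cmod (c * cnj z - 1))\<^sup>2 = (cmod (z - c))\<^sup>2 - ((cmod c)\<^sup>2 - 1) * (1 - (cmod z)\<^sup>2)"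
      "(cmod (c * cnj z - 1))\<^sup>2 = (((cmod c)\<^sup>2 + 1) * (1 + (cmod z)\<^sup>2) - 4 * (Re z * Re c + Im z *
          Im c)) - (cmod (z - c))\<^sup>2"
      unfolding cmod_power2 by (simp_all add: algebra_simps power2_eq_square)
    show "1 - (cmod (circle_inv c z))\<^sup>2 = ((cmod c)\<^sup>2 - 1) * (1 - (cmod z)\<^sup>2) / (cmod (z - c))\<^sup>2"
      unfolding m N(1) diff_divide_distrib using d by simp
    show "1 + (cmod (circle_inv c z))\<^sup>2 = (((cmod c)\<^sup>2 + 1) * (1 + (cmod z)\<^sup>2) - 4 * (Re z * Re c
        + Im z * Im c)) / (cmod (z - c))\<^sup>2"
      unfolding m N(2) diff_divide_distrib[of _ "(cmod (z - c))\<^sup>2"] using d by simp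
  qed
qed

lemma circle_inv_disk:
  assumes "z \<in> disk" "cmod c > 1"
  shows "circle_inv c z \<in> disk"
proof -
  have "z \<noteq> c" using assms by (auto simp: disk_def)
  moreover have "(cmod c)\<^sup>2 > 1" using assms by (simp add: one_less_power)
  ultimately have "1 - (cmod (circle_inv c z))\<^sup>2 > 0"
    unfolding circle_inv_cmod2(2)[OF assms] using disk_cmod2[OF assms(1)]
        by (intro divide_pos_pos mult_pos_pos) auto
  thus ?thesis by (simp add: disk_def power_less_one_iff)
qed

text \<open>On the hyperboloid the inversions become linear; the factor \<open>D / (K * Z)\<close>
  is the denominator of the image point computed in \<open>circle_inv_cmod2\<close>.\<close>

lemma hyp_circle_inv:
  assumes z: "z \<in> disk" and c: "cmod c > 1"
  shows "hyp (circle_inv c z) = vrefl c (hyp z)"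
proof -
  define D where "D = (cmod (z - c))\<^sup>2"
  define Z where "Z = 1 - (cmod z)\<^sup>2"
  define K where "K = (cmod c)\<^sup>2 - 1"
  have "z \<noteq> c" using assms by (auto simp: disk_def)
  hence D: "D > 0" by (simp add: D_def)
  have Z: "Z > 0" using disk_cmod2[OF z] by (simp add: Z_def)
  have K: "K > 0" using c by (simp add: one_less_power K_def)
  have h1: "1 / (1 - (cmod (circle_inv c z))\<^sup>2) = D / (K * Z)"
    unfolding circle_inv_cmod2(2)[OF assms] D_def Z_def K_def by simp
  have mi: "circle_inv c z = (1 / D) *\<^sub>R ((c * cnj z - 1) * (z - c))"
  proof -
    have "cnj z - cnj c \<noteq> 0" by (rule circle_inv_cmod2(1)[OF assms])
    moreover have "complex_of_real D = (z - c) * (cnj z - cnj c)"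
      unfolding D_def complex_norm_square by simp
    moreover have "(1 / D) *\<^sub>R ((c * cnj z - 1) * (z - c))
        = (c * cnj z - 1) * (z - c) / complex_of_real D"
      by (simp add: scaleR_conv_of_real)
    moreover have "circle_inv c z = ((c * cnj z - 1) * (z - c)) / ((z - c) * (cnj z - cnj c))"
      unfolding circle_inv_def using \<open>z \<noteq> c\<close> by simp
    ultimately show ?thesis by simp
  qed
  have hz: "hyp z = (1 / Z) *\<^sub>R (1 + (cmod z)\<^sup>2, 2 * z)" by (simp add: hyp_def Z_def)
  have "fst (hyp (circle_inv c z)) = fst (vrefl c (hyp z))"
  proof -
    have "fst (hyp (circle_inv c z)) = D / (K * Z) * (1 + (cmod (circle_inv c z))\<^sup>2)"
      unfolding hyp_def h1 by simp
    also have "\<dots> = ((K + 2) * (1 + (cmod z)\<^sup>2) - 4 * (Re z * Re c + Im z * Im c)) / (K * Z)"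
      unfolding circle_inv_cmod2(3)[OF assms] using D unfolding D_def K_def by simp
    also have "\<dots> = fst (vrefl c (hyp z))"
      unfolding vrefl_def hz K_def[symmetric] using Z K by (simp add: field_simps)
    finally show ?thesis .
  qed
  moreover have "snd (hyp (circle_inv c z)) = snd (vrefl c (hyp z))"
  proof -
    have "snd (hyp (circle_inv c z)) = (D / (K * Z)) *\<^sub>R (2 * circle_inv c z)"
      unfolding hyp_def h1 by simp
    also have "\<dots> = (1 / (K * Z)) *\<^sub>R (2 * ((c * cnj z - 1) * (z - c)))"
      unfolding mi using D by simp
    also have "\<dots> = snd (vrefl c (hyp z))"
    proof -
      have e: "(K * Z) *\<^sub>R snd (vrefl c (hyp z))
          = K *\<^sub>R (2 * z) + (2 * (1 + (cmod z)\<^sup>2 - 2 * (Re z * Re c + Im z * Im c))) *\<^sub>R c"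
        unfolding vrefl_def hz K_def[symmetric] using Z K
            by (simp add: field_simps scaleR_conv_of_real)
      also have "\<dots> = 2 * ((c * cnj z - 1) * (z - c))"
        unfolding K_def cmod_power2
        by (simp add: complex_eq_iff algebra_simps power2_eq_square)
      finally have "(1 / (K * Z)) *\<^sub>R ((K * Z) *\<^sub>R snd (vrefl c (hyp z)))
          = (1 / (K * Z)) *\<^sub>R (2 * ((c * cnj z - 1) * (z - c)))"
        by simp
      thus ?thesis using K Z by simp
    qed
    finally show ?thesis .
  qed
  ultimately show ?thesis by (simp add: prod_eq_iff)
qed

text \<open>\<open>pc\<close> and \<open>qc\<close> say that \<open>p\<close> and \<open>q\<close>
  lie on the circle around \<open>c\<close> orthogonal to the unit circle, that is
  \<open>(cmod (p - c))\<^sup>2 = (cmod c)\<^sup>2 - 1\<close> and likewise for \<open>q\<close>.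
  Both sides are fractional linear in \<open>cnj z\<close> and agree by polynomial
  identities.\<close>

lemma geo_refl_eq_circle_inv:
  assumes p: "p \<in> disk" and q: "q \<in> disk" and ne: "p \<noteq> q" and z: "z \<in> disk" and c: "cmod c > 1"
    and pc: "p * cnj p + 1 = p * cnj c + cnj p * c" and qc: "q * cnj q + 1 = q * cnj c + cnj q * c"
  shows "geo_refl p q z = circle_inv c z"
proof -
  have nz: "1 - cnj a * b \<noteq> 0" if "a \<in> disk" "b \<in> disk" for a b
  proof
    assume "1 - cnj a * b = 0"
    hence "cmod (cnj a * b) = 1" by (metis eq_iff_diff_eq_0 norm_one)
    moreover have "cmod (cnj a * b) < 1 * 1" unfolding norm_mult
      using that by (intro mult_strict_mono) (auto simp: disk_def)
    ultimately show False by simp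
  qed
  \<comment> \<open>Conjugates become independent variables for \<open>algebra\<close>, tied
    together only by \<open>pc'\<close> and \<open>qc'\<close>.\<close>
  define P Q Zc C where "P = cnj p" and "Q = cnj q" and "Zc = cnj z" and "C = cnj c"
  have pc': "p * P + 1 = p * C + P * c" and qc': "q * Q + 1 = q * C + Q * c"
    using pc qc by (simp_all add: P_def Q_def C_def)
  have n1: "1 - P * q \<noteq> 0" "1 - p * Q \<noteq> 0" "1 - P * z \<noteq> 0" "1 - p * Zc \<noteq> 0"
    using nz[OF p q] nz[OF q p] nz[OF p z] nz[OF z p]
        by (simp_all add: P_def Q_def Zc_def mult.commute)
  have n2: "Q - P \<noteq> 0" "q - p \<noteq> 0" using ne by (auto simp: P_def Q_def)
  have n3: "C - P \<noteq> 0" "Zc - C \<noteq> 0" using p z c by (auto simp: C_def P_def Zc_def disk_def)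
  define w where "w = (q - p) / (1 - P * q)"
  have w: "mob p q = w" by (simp add: mob_def w_def P_def)
  have cw: "cnj w = (Q - P) / (1 - p * Q)" by (simp add: w_def P_def Q_def)
  \<comment> \<open>The unimodular factor of the Euclidean reflection once \<open>p\<close> has been
    moved to 0; it depends only on \<open>p\<close> and the circle.\<close>
  define u where "u = w / cnj w"
  have u: "u = (p - c) / (C - P)"
  proof -
    have "(q - p) * (1 - p * Q) * (C - P) = (p - c) * ((Q - P) * (1 - P * q))"
      using pc' qc' by algebra
    moreover have "u = ((q - p) * (1 - p * Q)) / ((Q - P) * (1 - P * q))"
      unfolding u_def cw unfolding w_def by (simp add: divide_simps)
    moreover have "(Q - P) * (1 - P * q) \<noteq> 0" using n1 n2 by simp
    ultimately show ?thesis using frac_eq_eq[OF _ n3(1)] by blast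
  qed
  have mz: "cnj (mob p z) = (Zc - P) / (1 - p * Zc)" by (simp add: mob_def P_def Zc_def)
  have "geo_refl p q z = mob_inv p (u * cnj (mob p z))"
    by (simp add: geo_refl_def Let_def w u_def)
  also have "\<dots> = (u * ((Zc - P) / (1 - p * Zc)) + p) / (1 + P * (u * ((Zc - P) / (1 - p * Zc))))"
    unfolding mz mob_inv_def by (simp add: P_def)
  also have "\<dots> = ((p - c) * (Zc - P) + p * ((C - P) * (1 - p * Zc))) / ((C - P) * (1 - p * Zc) + P
      * ((p - c) * (Zc - P)))"
  proof -
    have "u * ((Zc - P) / (1 - p * Zc)) + p = ((p - c) * (Zc - P) + p * ((C - P) * (1 - p * Zc)))
        / ((C - P) * (1 - p * Zc))"
      "1 + P * (u * ((Zc - P) / (1 - p * Zc)))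
          = ((C - P) * (1 - p * Zc) + P * ((p - c) * (Zc - P))) / ((C - P) * (1 - p * Zc))"
      unfolding u using n1 n3 by (simp_all add: divide_simps)
    thus ?thesis using n1 n3 by simp
  qed
  also have "(p - c) * (Zc - P) + p * ((C - P) * (1 - p * Zc)) = (p * P - 1) * (c * Zc - 1)"
    using pc' by algebra
  also have "(C - P) * (1 - p * Zc) + P * ((p - c) * (Zc - P)) = (p * P - 1) * (Zc - C)"
    using pc' by algebra
  also have "(p * P - 1) * (c * Zc - 1) / ((p * P - 1) * (Zc - C)) = (c * Zc - 1) / (Zc - C)"
    using nz[OF p p] by (simp add: P_def mult.commute)
  finally show ?thesis by (simp add: circle_inv_def Zc_def C_def)
qed

section \<open>The base triangle in coordinates\<close>

lemma coshR_sq: "coshR\<^sup>2 = (2 + lam) / (3 * (2 - lam))"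
proof -
  have "cos (2 * (pi / 7)) = lam / 2" by (simp add: lam_def)
  hence c: "2 * (cos (pi / 7))\<^sup>2 = 1 + lam / 2" and s: "2 * (sin (pi / 7))\<^sup>2 = 1 - lam / 2"
    using cos_double_cos[of "pi / 7"] cos_double_sin[of "pi / 7"] by linarith+
  have "coshR\<^sup>2 = (cos (pi / 7))\<^sup>2 / (3 * (sin (pi / 7))\<^sup>2)"
    by (simp add: coshR_def cot_def power_divide power_mult_distrib)
  also have "\<dots> = (2 * (cos (pi / 7))\<^sup>2) / (3 * (2 * (sin (pi / 7))\<^sup>2))" by simp
  also have "\<dots> = (2 + lam) / (3 * (2 - lam))" unfolding c s using lam_bounds
      by (simp add: field_simps)
  finally show ?thesis .
qed

lemma coshR_gt_1: "coshR > 1"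
proof -
  have "coshR\<^sup>2 > 1\<^sup>2" unfolding coshR_sq using lam_bounds by (simp add: field_simps)
  moreover have "cos (pi / 7) > 0" by (rule cos_gt_zero) simp_all
  moreover have "sin (pi / 7) > 0" by (rule sin_gt_zero) simp_all
  ultimately have "coshR\<^sup>2 > 1\<^sup>2" "coshR \<ge> 0" unfolding coshR_def cot_def by simp_all
  thus ?thesis by (rule power_less_imp_less_base)
qed

text \<open>This is sinh R, because \<open>rho\<close> is tanh (R/2).\<close>

definition sinhR :: real where "sinhR = rho * (coshR + 1)"

definition root3 :: "nat \<Rightarrow> complex" where "root3 i = cis (2 * pi * real i / 3)"

lemma rho_sq: "rho\<^sup>2 = (coshR - 1) / (coshR + 1)"
  unfolding rho_def using coshR_gt_1 by simp

lemma rho_bounds: "0 < rho" "rho < 1"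
proof -
  show "0 < rho" unfolding rho_def using coshR_gt_1 by simp
  have "rho\<^sup>2 < 1\<^sup>2" unfolding rho_sq using coshR_gt_1 by simp
  thus "rho < 1" by (rule power_less_imp_less_base) simp
qed

lemma sinhR_pos: "sinhR > 0"
  using rho_bounds coshR_gt_1 by (simp add: sinhR_def)

lemma sinhR_sq: "sinhR\<^sup>2 = coshR\<^sup>2 - 1"
proof -
  have "sinhR\<^sup>2 = (coshR - 1) / (coshR + 1) * (coshR + 1)\<^sup>2"
    by (simp add: sinhR_def power_mult_distrib rho_sq)
  also have "\<dots> = (coshR - 1) * (coshR + 1)" using coshR_gt_1 by (simp add: power2_eq_square)
  finally show ?thesis by (simp add: power2_eq_square algebra_simps)
qed

lemma root3_values:
  "root3 0 = 1" "root3 (Suc 0) = Complex (- 1 / 2) (sqrt 3 / 2)"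
      "root3 2 = Complex (- 1 / 2) (- sqrt 3 / 2)"
proof -
  have 1: "2 * pi / 3 = pi - pi / 3" and 2: "2 * pi * 2 / 3 = pi / 3 + pi" by simp_all
  show "root3 0 = 1" by (simp add: root3_def)
  have "cos (2 * pi / 3) = - 1 / 2" "sin (2 * pi / 3) = sqrt 3 / 2"
    unfolding 1 by (simp_all only: cos_pi_minus sin_pi_minus cos_60 sin_60)
  thus "root3 (Suc 0) = Complex (- 1 / 2) (sqrt 3 / 2)" by (simp add: root3_def complex_eq_iff)
  have "cos (2 * pi * 2 / 3) = - (1 / 2)" "sin (2 * pi * 2 / 3) = - (sqrt 3 / 2)"
    unfolding 2 by (simp_all only: cos_periodic_pi sin_periodic_pi cos_60 sin_60)
  thus "root3 2 = Complex (- 1 / 2) (- sqrt 3 / 2)" by (simp add: root3_def complex_eq_iff)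
qed

lemma less_3_cases: "(i :: nat) < 3 \<Longrightarrow> i = 0 \<or> i = Suc 0 \<or> i = 2"
  by auto

lemma root3_inner:
  assumes "i < 3" "j < 3"
  shows "Re (root3 i) * Re (root3 j) + Im (root3 i) * Im (root3 j) = (if i = j then 1 else - 1 / 2)"
  using less_3_cases[OF assms(1)] less_3_cases[OF assms(2)] by (auto simp: root3_values)

lemma cmod_root3: "cmod (root3 i) = 1"
  by (simp add: root3_def)

lemma root3_sum: "root3 0 + root3 (Suc 0) + root3 2 = 0"
  by (simp add: root3_values complex_eq_iff)

lemma tri_vert_eq: "tri_vert i = complex_of_real rho * root3 i"
  by (simp add: tri_vert_def root3_def)

lemma cmod_tri_vert: "cmod (tri_vert i) = rho"
  using rho_bounds by (simp add: tri_vert_eq norm_mult cmod_root3)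

lemma tri_vert_disk: "tri_vert i \<in> disk"
  using rho_bounds by (simp add: disk_def cmod_tri_vert)

definition base_vert :: "nat \<Rightarrow> vec" where "base_vert i = (coshR, complex_of_real sinhR * root3 i)"

lemma hyp_tri_vert: "hyp (tri_vert i) = base_vert i"
proof -
  have 1: "1 + rho\<^sup>2 = 2 * coshR / (coshR + 1)" "1 - rho\<^sup>2 = 2 / (coshR + 1)"
    unfolding rho_sq using coshR_gt_1 by (simp_all add: field_simps)
  have 2: "1 / (2 / (coshR + 1)) = (coshR + 1) / 2" by simp
  have "(coshR + 1) / 2 * (2 * coshR / (coshR + 1)) = coshR" using coshR_gt_1 by simp
  hence "fst (hyp (tri_vert i)) = coshR"
    by (simp only: hyp_def cmod_tri_vert 1 2 fst_scaleR fst_conv real_scaleR_def)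
  moreover have "snd (hyp (tri_vert i)) = complex_of_real sinhR * root3 i"
    unfolding hyp_def cmod_tri_vert 1 2 by (simp add: scaleR_conv_of_real sinhR_def tri_vert_eq
        algebra_simps)
  ultimately show ?thesis by (simp add: base_vert_def prod_eq_iff)
qed

lemma mform_base_vert:
  assumes "i < 3" "j < 3"
  shows "mform (base_vert i) (base_vert j) = (if i = j then 2 - lam else lam)"
proof -
  have "mform (base_vert i) (base_vert j) = (2 - lam) * (coshR\<^sup>2 - sinhR\<^sup>2 * (Re (root3 i) * Re
      (root3 j) + Im (root3 i) * Im (root3 j)))"
    by (simp add: mform_def base_vert_def power2_eq_square algebra_simps)
  also have "\<dots> = (if i = j then 2 - lam else lam)"
  proof (cases "i = j")
    case False
    have "3 * (2 - lam) * coshR\<^sup>2 = 2 + lam" unfolding coshR_sq using lam_bounds by simp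
    hence "(2 - lam) * (coshR\<^sup>2 - (coshR\<^sup>2 - 1) * (- 1 / 2)) = lam" by (simp add: field_simps)
    thus ?thesis unfolding root3_inner[OF assms] sinhR_sq using False by simp
  next
    case True
    thus ?thesis unfolding root3_inner[OF assms] sinhR_sq by simp
  qed
  finally show ?thesis .
qed

text \<open>Centre of the circle carrying side \<open>i\<close>, in the direction opposite to the
  remaining vertex. The distance \<open>2 * coshR / sinhR\<close> makes \<open>(1, centre i)\<close>
  Minkowski-orthogonal to both ends of the side.\<close>

definition centre :: "nat \<Rightarrow> complex" where
  "centre i = - complex_of_real (2 * coshR / sinhR) * root3 ((i + 2) mod 3)"

lemma cmod_centre: "cmod (centre i) = 2 * coshR / sinhR" "cmod (centre i) > 1"
proof -
  show 1: "cmod (centre i) = 2 * coshR / sinhR"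
    using coshR_gt_1 sinhR_pos by (simp add: centre_def norm_mult norm_divide cmod_root3)
  have "sinhR\<^sup>2 < coshR\<^sup>2" by (simp add: sinhR_sq)
  hence "sinhR < coshR" using coshR_gt_1 by (intro power_less_imp_less_base[of sinhR 2]) auto
  thus "cmod (centre i) > 1" unfolding 1 using sinhR_pos by (simp add: field_simps)
qed

lemma side_refl_eq_circle_inv:
  assumes "i < 3" "z \<in> disk"
  shows "side_refl i z = circle_inv (centre i) z"
  unfolding side_refl_def
proof (rule geo_refl_eq_circle_inv[OF tri_vert_disk tri_vert_disk _ assms(2) cmod_centre(2)])
  have on: "tri_vert j * cnj (tri_vert j) + 1
      = tri_vert j * cnj (centre i) + cnj (tri_vert j) * centre i"
    if j: "j < 3" "j \<noteq> (i + 2) mod 3" for j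
  proof -
    have "tri_vert j * cnj (tri_vert j) + 1 = complex_of_real (rho\<^sup>2 + 1)"
      using complex_norm_square[of "tri_vert j"] by (simp add: cmod_tri_vert)
    also have "rho\<^sup>2 + 1 = 2 * rho * (coshR / sinhR)"
    proof -
      have "rho\<^sup>2 + 1 = 2 * coshR / (coshR + 1)"
        unfolding rho_sq using coshR_gt_1 by (simp add: field_simps)
      also have "\<dots> = 2 * rho * (coshR / sinhR)"
        unfolding sinhR_def using coshR_gt_1 rho_bounds by simp
      finally show ?thesis .
    qed
    also have "complex_of_real \<dots> = tri_vert j * cnj (centre i) + cnj (tri_vert j) * centre i"
    proof -
      have "root3 j * cnj (root3 ((i + 2) mod 3)) + cnj (root3 j) * root3 ((i + 2) mod 3) = - 1"
        using root3_inner[OF j(1), of "(i + 2) mod 3"] j(2)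
            by (simp add: complex_eq_iff algebra_simps)
      moreover have "tri_vert j * cnj (centre i) + cnj (tri_vert j) * centre i =
        - complex_of_real (2 * rho * (coshR / sinhR)) *
          (root3 j * cnj (root3 ((i + 2) mod 3)) + cnj (root3 j) * root3 ((i + 2) mod 3))"
        by (simp add: tri_vert_eq centre_def algebra_simps)
      ultimately show ?thesis by simp
    qed
    finally show ?thesis .
  qed
  show "tri_vert i * cnj (tri_vert i) + 1 = tri_vert i * cnj (centre i) + cnj (tri_vert i) *
      centre i"
    by (rule on) (use less_3_cases[OF assms(1)] in auto)
  show "tri_vert ((i + 1) mod 3) * cnj (tri_vert ((i + 1) mod 3)) + 1 =
      tri_vert ((i + 1) mod 3) * cnj (centre i) + cnj (tri_vert ((i + 1) mod 3)) * centre i"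
    by (rule on) (use less_3_cases[OF assms(1)] in auto)
  show "tri_vert i \<noteq> tri_vert ((i + 1) mod 3)"
    using less_3_cases[OF assms(1)] rho_bounds 
    by (auto simp: tri_vert_eq root3_values root3_values(3)[unfolded numeral_2_eq_2] complex_eq_iff)
qed

lemma vrefl_base_vert_fix:
  assumes "j < 3" "j \<noteq> (i + 2) mod 3"
  shows "vrefl (centre i) (base_vert j) = base_vert j"
proof -
  let ?k = "(i + 2) mod 3"
  have "fst (base_vert j) - Re (snd (base_vert j)) * Re (centre i) - Im (snd (base_vert j)) * Im
      (centre i)
    = coshR + 2 * coshR * (Re (root3 j) * Re (root3 ?k) + Im (root3 j) * Im (root3 ?k))"
    using sinhR_pos by (simp add: base_vert_def centre_def algebra_simps)
  also have "\<dots> = 0" using root3_inner[OF assms(1), of ?k] assms(2) by simp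
  finally show ?thesis by (simp add: vrefl_def zero_prod_def)
qed

text \<open>This identifies the reflection in a side of the base face with the flip of
  \<open>tri\<close>; the constants match by \<open>coshR_sq\<close>.\<close>

lemma vrefl_base_vert_flip:
  assumes i: "i < 3"
  shows "vrefl (centre i) (base_vert ((i + 2) mod 3))
    = lam *\<^sub>R (base_vert i + base_vert ((i + 1) mod 3)) - base_vert ((i + 2) mod 3)"
proof -
  let ?k = "(i + 2) mod 3"
  have 3: "3 * (2 - lam) * coshR\<^sup>2 = 2 + lam" unfolding coshR_sq using lam_bounds by simp
  have "fst (base_vert ?k) - Re (snd (base_vert ?k)) * Re (centre i) - Im (snd (base_vert ?k)) *
      Im (centre i)
    = coshR + 2 * coshR * (Re (root3 ?k) * Re (root3 ?k) + Im (root3 ?k) * Im (root3 ?k))"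
    using sinhR_pos by (simp add: base_vert_def centre_def algebra_simps)
  also have "\<dots> = 3 * coshR" using root3_inner[of ?k ?k] by simp
  finally have f: "fst (base_vert ?k) - Re (snd (base_vert ?k)) * Re (centre i) - Im (snd
      (base_vert ?k)) * Im (centre i) = 3 * coshR" .
  have S: "sinhR\<^sup>2 = coshR\<^sup>2 - 1" by (rule sinhR_sq)
  have "(cmod (centre i))\<^sup>2 - 1 = (3 * coshR\<^sup>2 + 1) / sinhR\<^sup>2"
  proof -
    have "(2 * coshR)\<^sup>2 - sinhR\<^sup>2 = 3 * coshR\<^sup>2 + 1" by (simp add: S power_mult_distrib)
    hence "((2 * coshR)\<^sup>2 - sinhR\<^sup>2) / sinhR\<^sup>2 = (3 * coshR\<^sup>2 + 1) / sinhR\<^sup>2" by (rule arg_cong)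
    thus ?thesis unfolding cmod_centre power_divide diff_divide_distrib using sinhR_pos by simp
  qed
  hence "2 * (3 * coshR) / ((cmod (centre i))\<^sup>2 - 1) = 6 * coshR * sinhR\<^sup>2 / (3 * coshR\<^sup>2 + 1)"
      by simp
  also have "\<dots> = 2 * coshR * (lam - 1)"
  proof -
    have "3 * coshR\<^sup>2 + 1 > 0" by (simp add: add_nonneg_pos)
    moreover have "(2 - lam) * (6 * sinhR\<^sup>2) = (2 - lam) * (2 * (lam - 1) * (3 * coshR\<^sup>2 + 1))"
      using 3 unfolding S by algebra
    hence "6 * sinhR\<^sup>2 = 2 * (lam - 1) * (3 * coshR\<^sup>2 + 1)" using lam_bounds by simp
    hence "6 * coshR * sinhR\<^sup>2 = 2 * coshR * (lam - 1) * (3 * coshR\<^sup>2 + 1)" by algebra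
    ultimately show ?thesis by (simp add: nonzero_divide_eq_eq)
  qed
  finally have g: "2 * (3 * coshR) / ((cmod (centre i))\<^sup>2 - 1) = 2 * coshR * (lam - 1)" .
  have wsum: "root3 i + root3 ((i + 1) mod 3) = - root3 ?k"
    using less_3_cases[OF i] root3_sum by (auto simp: eq_neg_iff_add_eq_0 ac_simps numeral_2_eq_2)
  have c: "2 * coshR * (lam - 1) * (2 * coshR / sinhR) = sinhR * (lam + 2)"
  proof -
    have "(2 - lam) * (4 * coshR\<^sup>2 * (lam - 1)) = (2 - lam) * (sinhR\<^sup>2 * (lam + 2))"
      using 3 unfolding S by algebra
    hence "4 * coshR\<^sup>2 * (lam - 1) = sinhR\<^sup>2 * (lam + 2)" using lam_bounds by simp
    thus ?thesis using sinhR_pos by (simp add: field_simps power2_eq_square)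
  qed
  have "snd (vrefl (centre i) (base_vert ?k))
      = complex_of_real sinhR * root3 ?k - complex_of_real (2 * coshR * (lam - 1) * (2 * coshR /
          sinhR)) * root3 ?k"
    unfolding vrefl_def f g by (simp add: base_vert_def centre_def scaleR_conv_of_real)
  also have "\<dots> = lam *\<^sub>R (complex_of_real sinhR * (root3 i + root3 ((i + 1) mod 3))) -
      complex_of_real sinhR * root3 ?k"
    unfolding c wsum by (simp add: scaleR_conv_of_real algebra_simps)
  also have "\<dots> = snd (lam *\<^sub>R (base_vert i + base_vert ((i + 1) mod 3)) - base_vert ?k)"
    by (simp add: base_vert_def algebra_simps)
  finally have "snd (vrefl (centre i) (base_vert ?k))
      = snd (lam *\<^sub>R (base_vert i + base_vert ((i + 1) mod 3)) - base_vert ?k)" .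
  moreover have "fst (vrefl (centre i) (base_vert ?k))
      = fst (lam *\<^sub>R (base_vert i + base_vert ((i + 1) mod 3)) - base_vert ?k)"
    unfolding vrefl_def f g by (simp add: base_vert_def algebra_simps)
  ultimately show ?thesis by (simp add: prod_eq_iff)
qed

section \<open>Faces as images of the base triangle under the reflection group\<close>

interpretation hyp_frame "base_vert 0" "base_vert (Suc 0)" "base_vert 2"
proof
  show "gram (base_vert 0) (base_vert (Suc 0)) (base_vert 2)"
      by (simp add: gram_def mform_base_vert)
qed (use coshR_gt_1 in \<open>simp_all add: base_vert_def\<close>)

text \<open>The one instance of linearity that carries flips to flips.\<close>

definition flip_linear :: "(vec \<Rightarrow> vec) \<Rightarrow> bool" where
  "flip_linear f \<longleftrightarrow> (\<forall>r x y z. f (r *\<^sub>R (x + y) - z) = r *\<^sub>R (f x + f y) - f z)"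

lemma flip_linearD: "flip_linear f \<Longrightarrow> f (r *\<^sub>R (x + y) - z) = r *\<^sub>R (f x + f y) - f z"
  unfolding flip_linear_def by blast

lemma flip_linear_comp:
  assumes "flip_linear f" "flip_linear g"
  shows "flip_linear (f \<circ> g)"
  unfolding flip_linear_def o_def flip_linearD[OF assms(2)] flip_linearD[OF assms(1)] by blast

lemma tri_map:
  assumes "tri a b c x y z" "flip_linear f"
  shows "tri (f a) (f b) (f c) (f x) (f y) (f z)"
  using assms
proof induction
  case base
  show ?case by (rule tri.base)
next
  case (swap12 x y z)
  show ?case by (rule tri.swap12[OF swap12.IH[OF swap12.prems]])
next
  case (swap23 x y z)
  show ?case by (rule tri.swap23[OF swap23.IH[OF swap23.prems]])
next
  case (flip x y z)
  have "f (lam *\<^sub>R (x + y) - z) = lam *\<^sub>R (f x + f y) - f z"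
    by (rule flip_linearD[OF flip.prems])
  thus ?case using tri.flip[OF flip.IH[OF flip.prems]] by simp
qed

lemma T_vrefl:
  assumes "i < 3"
  shows "T (vrefl (centre i) (base_vert 0)) (vrefl (centre i) (base_vert (Suc 0))) (vrefl (centre
      i) (base_vert 2))"
proof -
  have b: "T (base_vert 0) (base_vert (Suc 0)) (base_vert 2)" by (rule tri.base)
  consider "i = 0" | "i = Suc 0" | "i = 2" using less_3_cases[OF assms] by blast
  thus ?thesis
  proof cases
    case 1
    hence "vrefl (centre i) (base_vert 0) = base_vert 0"
        "vrefl (centre i) (base_vert (Suc 0)) = base_vert (Suc 0)"
      "vrefl (centre i) (base_vert 2) = lam *\<^sub>R (base_vert 0 + base_vert (Suc 0)) - base_vert 2"
      using vrefl_base_vert_fix[of 0 i] vrefl_base_vert_fix[of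
          "Suc 0" i] vrefl_base_vert_flip[of i] by (simp_all add: numeral_2_eq_2)
    thus ?thesis using tri.flip[OF b] by simp
  next
    case 2
    hence "vrefl (centre i) (base_vert 2) = base_vert 2"
        "vrefl (centre i) (base_vert (Suc 0)) = base_vert (Suc 0)"
      "vrefl (centre i) (base_vert 0) = lam *\<^sub>R (base_vert (Suc 0) + base_vert 2) - base_vert 0"
      using vrefl_base_vert_fix[of 2 i] vrefl_base_vert_fix[of
          "Suc 0" i] vrefl_base_vert_flip[of i] by (simp_all add: numeral_2_eq_2)
    thus ?thesis using T_perm(1)[OF T_perm(2)[OF tri.flip[OF T_perm(2)[OF T_perm(1)[OF b]]]]]
        by simp
  next
    case 3
    hence "vrefl (centre i) (base_vert 2) = base_vert 2"
        "vrefl (centre i) (base_vert 0) = base_vert 0"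
      "vrefl (centre i) (base_vert (Suc 0)) = lam *\<^sub>R (base_vert 2 + base_vert 0) - base_vert (Suc
          0)"
      using vrefl_base_vert_fix[of 2 i] vrefl_base_vert_fix[of 0 i] vrefl_base_vert_flip[of i]
          by simp_all
    thus ?thesis using T_perm(2)[OF tri.flip[OF T_perm(2)[OF b]]] by (simp add: add.commute)
  qed
qed

lemma side_refl_disk:
  assumes "i < 3" "z \<in> disk"
  shows "side_refl i z \<in> disk" "hyp (side_refl i z) = vrefl (centre i) (hyp z)"
  using circle_inv_disk[OF assms(2) cmod_centre(2)] hyp_circle_inv[OF assms(2) cmod_centre(2)]
  by (simp_all add: side_refl_eq_circle_inv[OF assms])

text \<open>For the last claim, a reflection carries a chain of flips from the base face to its
  image under \<open>G\<close> to a chain starting at the mirror image of the base face, which is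
  itself reachable by \<open>T_vrefl\<close>.\<close>

lemma refl_group_linear:
  assumes "g \<in> refl_group"
  obtains G where "flip_linear G" "\<And>z. z \<in> disk \<Longrightarrow> g z \<in> disk" "\<And>z. z \<in> disk \<Longrightarrow> hyp (g z) = G (hyp z)"
    "T (G (base_vert 0)) (G (base_vert (Suc 0))) (G (base_vert 2))"
proof -
  have "\<exists>G. flip_linear G \<and> (\<forall>z\<in>disk. g z \<in> disk \<and> hyp (g z) = G (hyp z)) \<and>
    T (G (base_vert 0)) (G (base_vert (Suc 0))) (G (base_vert 2))"
    using assms
  proof induction
    case id_in
    show ?case by (rule exI[of _ id]) (simp add: flip_linear_def tri.base)
  next
    case (step g i)
    then obtain G where G: "flip_linear G" "\<And>z. z \<in> disk \<Longrightarrow> g z \<in> disk \<and> hyp (g z) = G (hyp z)"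
      "T (G (base_vert 0)) (G (base_vert (Suc 0))) (G (base_vert 2))" by blast
    have v: "flip_linear (vrefl (centre i))" by (simp add: flip_linear_def vrefl_linear)
    note flip_linear_comp[OF v G(1)]
    moreover have "T ((vrefl (centre i) \<circ> G) (base_vert 0)) ((vrefl (centre i) \<circ> G) (base_vert
        (Suc 0))) ((vrefl (centre i) \<circ> G) (base_vert 2))"
      unfolding o_def by (rule tri_trans[OF tri_map[OF G(3) v] T_vrefl[OF step.hyps(2)]])
    ultimately show ?case using G(2) side_refl_disk[OF step.hyps(2)]
      by (intro exI[of _ "vrefl (centre i) \<circ> G"] conjI) (assumption | simp)+
  qed
  thus thesis using that by blast
qed

text \<open>\<open>refl_group\<close> grows on the left, but passing from the image of the triangle
  under \<open>g\<close> to the face across one of its sides multiplies \<open>g\<close> on the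
  right.\<close>

lemma refl_group_right:
  assumes "g \<in> refl_group" "i < 3"
  shows "g \<circ> side_refl i \<in> refl_group"
  using assms
proof induction
  case id_in
  thus ?case using refl_group.step[OF refl_group.id_in] by simp
next
  case (step g j)
  show ?case
    unfolding comp_assoc by (rule refl_group.step[OF step.IH[OF step.prems] step.hyps(2)])
qed

definition perm3 :: "nat \<Rightarrow> nat \<Rightarrow> nat \<Rightarrow> bool" where
  "perm3 i j k \<longleftrightarrow> i < 3 \<and> j < 3 \<and> k < 3 \<and> i \<noteq> j \<and> i \<noteq> k \<and> j \<noteq> k"

lemma perm3_swap: "perm3 i j k \<Longrightarrow> perm3 j i k" "perm3 i j k \<Longrightarrow> perm3 i k j"
  by (simp_all add: perm3_def)

text \<open>Flipping the face of \<open>g\<close> over the image of side \<open>s\<close> gives the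
  face of \<open>g \<circ> side_refl s\<close>.\<close>

lemma T_imp_refl_group:
  assumes "T x y z"
  shows "\<exists>g\<in>refl_group. \<exists>i j k. perm3 i j k \<and> x = hyp (g (tri_vert i)) \<and> y = hyp (g (tri_vert j))
      \<and> z = hyp (g (tri_vert k))"
  using assms
proof induction
  case base
  show ?case
    by (rule bexI[OF _ refl_group.id_in], rule exI[of _ 0], rule exI[of _
        "Suc 0"], rule exI[of _ 2])
      (simp add: hyp_tri_vert perm3_def)
next
  case (swap12 x y z)
  thus ?case using perm3_swap(1) by blast
next
  case (swap23 x y z)
  thus ?case using perm3_swap(2) by blast
next
  case (flip x y z)
  then obtain g i j k where g: "g \<in> refl_group" and ijk: "perm3 i j k"
    and eq: "x = hyp (g (tri_vert i))" "y = hyp (g (tri_vert j))" "z = hyp (g (tri_vert k))"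
        by blast
  obtain G where G: "flip_linear G" "\<And>z. z \<in> disk \<Longrightarrow> g z \<in> disk"
      "\<And>z. z \<in> disk \<Longrightarrow> hyp (g z) = G (hyp z)"
    using refl_group_linear[OF g] by blast
  \<comment> \<open>The side opposite to vertex \<open>k\<close>: side \<open>s\<close> joins
    \<open>s\<close> and \<open>s + 1\<close> and misses \<open>s + 2\<close>, modulo 3.\<close>
  define s where "s = (k + 1) mod 3"
  have lt: "i < 3" "j < 3" "k < 3" and dist: "i \<noteq> j" "i \<noteq> k" "j \<noteq> k"
    using ijk by (simp_all add: perm3_def)
  have s: "s < 3" "(s + 2) mod 3 = k" using lt less_3_cases[of k] by (auto simp: s_def)
  have sij: "base_vert s + base_vert ((s + 1) mod 3) = base_vert i + base_vert j"
    using lt dist less_3_cases[of i] less_3_cases[of j] less_3_cases[of k]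
        by (auto simp: s_def add.commute numeral_2_eq_2)
  have val: "hyp ((g \<circ> side_refl s) (tri_vert l)) = G (vrefl (centre s) (base_vert l))" for l
    using G(3) side_refl_disk[OF s(1) tri_vert_disk[of l]] by (simp add: hyp_tri_vert)
  have "hyp ((g \<circ> side_refl s) (tri_vert i)) = x" "hyp ((g \<circ> side_refl s) (tri_vert j)) = y"
    unfolding val eq G(3)[OF tri_vert_disk] hyp_tri_vert
    using vrefl_base_vert_fix[of i s] vrefl_base_vert_fix[of j s] lt dist s by simp_all
  moreover have "hyp ((g \<circ> side_refl s) (tri_vert k)) = lam *\<^sub>R (x + y) - z"
    unfolding val eq G(3)[OF tri_vert_disk] hyp_tri_vert
    using vrefl_base_vert_flip[OF s(1)] unfolding s(2) sij by (simp only: flip_linearD[OF G(1)])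
  ultimately show ?case
    by (intro bexI[OF _ refl_group_right[OF g s(1)]] exI[of _ i] exI[of _ j] exI[of _ k] conjI ijk)
      (rule sym, assumption)+
qed

lemma T_images:
  assumes "g \<in> refl_group" "perm3 i j k"
  shows "T (hyp (g (tri_vert i))) (hyp (g (tri_vert j))) (hyp (g (tri_vert k)))"
proof -
  obtain G where G: "\<And>z. z \<in> disk \<Longrightarrow> hyp (g z) = G (hyp z)"
    "T (G (base_vert 0)) (G (base_vert (Suc 0))) (G (base_vert 2))"
    using refl_group_linear[OF assms(1)] by blast
  have v: "hyp (g (tri_vert l)) = G (base_vert l)" for l
    by (simp add: G(1)[OF tri_vert_disk] hyp_tri_vert)
  have lt: "i < 3" "j < 3" "k < 3" and ne: "i \<noteq> j" "i \<noteq> k" "j \<noteq> k"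
    using assms(2) by (simp_all add: perm3_def)
  show ?thesis
    unfolding v using less_3_cases[OF lt(1)] less_3_cases[OF lt(2)] less_3_cases[OF lt(3)] ne G(2)
        T_perm(1)[OF G(2)]
      T_perm(2)[OF G(2)] T_perm(3)[OF G(2)] T_perm(2)[OF T_perm(1)[OF G(2)]] T_perm(1)[OF
          T_perm(2)[OF G(2)]]
    by (elim disjE) simp_all
qed

lemma ex_perm3:
  assumes "i < 3" "j < 3" "i \<noteq> j"
  shows "\<exists>k. perm3 i j k"
  using less_3_cases[OF assms(1)] less_3_cases[OF assms(2)] assms(3)
  by (intro exI[of _ "3 - i - j"]) (elim disjE; simp add: perm3_def)

lemma refl_group_disk: "g \<in> refl_group \<Longrightarrow> g (tri_vert i) \<in> disk"
  using refl_group_linear tri_vert_disk by metis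

lemma Vert_disk: "v \<in> Vert \<Longrightarrow> v \<in> disk"
  unfolding Vert_def using refl_group_disk by blast

lemma Vert_hyp: "v \<in> Vert \<Longrightarrow> hyp v \<in> verts"
proof -
  assume "v \<in> Vert"
  then obtain g i where g: "g \<in> refl_group" "i < 3" "v = g (tri_vert i)" by (auto simp: Vert_def)
  obtain j where j: "j < 3" "i \<noteq> j" using that[of "if i = 0 then 1 else 0"] by auto
  then obtain k where "perm3 i j k" using ex_perm3 g by blast
  thus ?thesis using T_verts(1)[OF T_images] g by blast
qed

lemma verts_Vert: assumes "x \<in> verts" obtains v where "v \<in> Vert" "hyp v = x"
proof -
  obtain y z where "T x y z" using assms by (auto simp: verts_def)
  then obtain g i j k where "g \<in> refl_group" "perm3 i j k" "x = hyp (g (tri_vert i))"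
    using T_imp_refl_group by blast
  thus thesis using that[of "g (tri_vert i)"] unfolding Vert_def perm3_def by blast
qed

lemma adj_imp_Vert: "adj v w \<Longrightarrow> v \<in> Vert \<and> w \<in> Vert"
  unfolding adj_def Vert_def by blast

lemma adj_imp_adjv:
  assumes "adj v w" shows "adjv (hyp v) (hyp w)"
proof -
  obtain g i j where g: "g \<in> refl_group" "i < 3" "j < 3" "i \<noteq> j" "v = g (tri_vert i)"
      "w = g (tri_vert j)"
    using assms unfolding adj_def by blast
  then obtain k where "perm3 i j k" using ex_perm3 by blast
  thus ?thesis using T_images[OF g(1)] unfolding adjv_def g(5,6) by blast
qed

lemma adjv_imp_adj:
  assumes "adjv (hyp v) (hyp w)" "v \<in> Vert" "w \<in> Vert" shows "adj v w"
proof -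
  obtain z where "T (hyp v) (hyp w) z" using assms(1) unfolding adjv_def by blast
  then obtain g i j k where g: "g \<in> refl_group" "perm3 i j k" "hyp v = hyp (g (tri_vert i))"
      "hyp w = hyp (g (tri_vert j))"
    using T_imp_refl_group by blast
  have "v = g (tri_vert i)" "w = g (tri_vert j)"
    using hyp_inj[OF Vert_disk refl_group_disk[OF g(1)]] assms(2,3) g(3,4) by blast+
  thus ?thesis using g(1,2) unfolding adj_def perm3_def by blast
qed

lemma bij_hyp_neighbours:
  assumes "v \<in> Vert"
  shows "bij_betw hyp {u. adj v u} {y. adjv (hyp v) y}"
  unfolding bij_betw_def
proof
  show "inj_on hyp {u. adj v u}"
    using hyp_inj Vert_disk adj_imp_Vert by (intro inj_onI) blast
  show "hyp ` {u. adj v u} = {y. adjv (hyp v) y}"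
  proof (intro equalityI subsetI)
    fix y assume "y \<in> {y. adjv (hyp v) y}"
    hence y: "adjv (hyp v) y" by simp
    then obtain u where "u \<in> Vert" "hyp u = y" using verts_Vert adjv_verts(2) by blast
    thus "y \<in> hyp ` {u. adj v u}" using adjv_imp_adj y assms by blast
  qed (use adj_imp_adjv in blast)
qed

section \<open>Graph distance as half the number of separating lines\<close>

lemma relpow_adj_sep_count:
  assumes "o0 \<in> Vert" "(adj ^^ n) o0 v"
  shows "v \<in> Vert \<and> sep_count (hyp o0) (hyp v) \<le> 2 * n"
  using assms(2)
proof (induction n arbitrary: v)
  case 0
  thus ?case using assms(1) by simp
next
  case (Suc n)
  then obtain u where u: "(adj ^^ n) o0 u" "adj u v" by auto
  have "int (sep_count (hyp o0) (hyp v)) \<le> int (sep_count (hyp o0) (hyp u)) + 2"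
    by (rule sep_count_step[OF adj_imp_adjv[OF u(2)] Vert_hyp[OF assms(1)]])
  thus ?case using Suc.IH[OF u(1)] adj_imp_Vert[OF u(2)] by simp
qed

lemma ex_descent:
  assumes "o0 \<in> Vert" "v \<in> Vert" "v \<noteq> o0"
  shows "\<exists>u. adj v u \<and> sep_count (hyp o0) (hyp v) = sep_count (hyp o0) (hyp u) + 2"
proof -
  have "hyp o0 \<noteq> hyp v" using hyp_inj[OF Vert_disk[OF assms(1)] Vert_disk[OF assms(2)]] assms(3)
      by blast
  then obtain y where y: "adjv (hyp v) y" "int (sep_count (hyp o0) y)
      = int (sep_count (hyp o0) (hyp v)) - 2"
    using sep_count_descent[OF Vert_hyp[OF assms(1)] Vert_hyp[OF assms(2)]] by blast
  then obtain u where u: "u \<in> Vert" "hyp u = y" using verts_Vert adjv_verts(2) by blast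
  hence "adj v u" using adjv_imp_adj y(1) assms(2) by blast
  thus ?thesis using y(2) u(2) by (intro exI[of _ u]) simp
qed

lemma adj_commute: "adj v u \<Longrightarrow> adj u v"
  unfolding adj_def by blast

lemma ex_relpow_adj:
  assumes "o0 \<in> Vert" "v \<in> Vert"
  shows "\<exists>n. (adj ^^ n) o0 v \<and> sep_count (hyp o0) (hyp v) = 2 * n"
  using assms(2)
proof (induction "sep_count (hyp o0) (hyp v)" arbitrary: v rule: less_induct)
  case less
  show ?case
  proof (cases "v = o0")
    case True
    thus ?thesis by (intro exI[of _ 0]) simp
  next
    case False
    then obtain u where u: "adj v u" "sep_count (hyp o0) (hyp v) = sep_count (hyp o0) (hyp u) + 2"
      using ex_descent[OF assms(1) less.prems] by blast
    then obtain n where "(adj ^^ n) o0 u" "sep_count (hyp o0) (hyp u) = 2 * n"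
      using less.hyps[of u] adj_imp_Vert[OF u(1)] by auto
    thus ?thesis using u(2) adj_commute[OF u(1)] by (intro exI[of _ "Suc n"]) auto
  qed
qed

text \<open>A path of length \<open>n\<close> accounts for at most \<open>2 * n\<close> separating
  lines, and descent from \<open>v\<close> yields a path that attains this bound.\<close>

lemma sep_count_eq_gdist:
  assumes "o0 \<in> Vert" "v \<in> Vert"
  shows "sep_count (hyp o0) (hyp v) = 2 * gdist o0 v"
proof -
  obtain n where n: "(adj ^^ n) o0 v" "sep_count (hyp o0) (hyp v) = 2 * n"
      using ex_relpow_adj[OF assms] by blast
  have "gdist o0 v = n" unfolding gdist_def
  proof (rule Least_equality)
    fix k assume "(adj ^^ k) o0 v"
    thus "n \<le> k" using relpow_adj_sep_count[OF assms(1)] n(2) by fastforce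
  qed (rule n(1))
  thus ?thesis using n(2) by simp
qed

section \<open>Waves of topplings\<close>

lemma legal_seq_append:
  "legal_seq S \<psi> (xs @ ys) \<longleftrightarrow> legal_seq S \<psi> xs \<and> legal_seq S (run_topplings S \<psi> xs) ys"
  by (induction xs arbitrary: \<psi>) auto

text \<open>All that the sandpile argument uses of the tiling.\<close>

locale layered_graph =
  fixes o0 :: complex
  assumes o0: "o0 \<in> Vert"
    and adj_Vert: "adj v u \<Longrightarrow> u \<in> Vert"
    and adj_sym: "adj v u \<Longrightarrow> adj u v"
    and adj_irrefl: "\<not> adj v v"
    and card_adj: "v \<in> Vert \<Longrightarrow> card {u. adj v u} = 7"
    and gdist_step: "adj v u \<Longrightarrow> gdist o0 u \<le> gdist o0 v + 1"
    and gdist_descent: "v \<in> Vert \<Longrightarrow> v \<noteq> o0 \<Longrightarrow> \<exists>u. adj v u \<and> gdist o0 u < gdist o0 v"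
    and gdist_subharmonic: "v \<in> Vert \<Longrightarrow> (\<Sum>u | adj v u. int (gdist o0 u) - int (gdist o0 v)) \<ge> 1"
begin

abbreviation "L \<equiv> gdist o0"
abbreviation "Gam \<equiv> Gamma_ball o0"

lemma finite_adj: "v \<in> Vert \<Longrightarrow> finite {u. adj v u}"
  using card_adj card_ge_0_finite[of "{u. adj v u}"] by simp

lemma Gam_Vert: "Gam m \<subseteq> Vert"
  by (auto simp: Gamma_ball_def)

lemma finite_Gam: "finite (Gam m)"
proof (induction m)
  case 0
  have "Gam 0 \<subseteq> {o0}" using gdist_descent by (fastforce simp: Gamma_ball_def)
  thus ?case by (rule finite_subset) simp
next
  case (Suc m)
  have "Gam (Suc m) \<subseteq> {o0} \<union> (\<Union>w\<in>Gam m. {u. adj w u})"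
  proof
    fix v assume v: "v \<in> Gam (Suc m)"
    show "v \<in> {o0} \<union> (\<Union>w\<in>Gam m. {u. adj w u})"
    proof (cases "v = o0")
      case False
      then obtain u where u: "adj v u" "L u < L v" using v gdist_descent
          by (auto simp: Gamma_ball_def)
      hence "u \<in> Gam m" using v adj_Vert by (auto simp: Gamma_ball_def)
      thus ?thesis using adj_sym[OF u(1)] by blast
    qed simp
  qed
  moreover have "finite ({o0} \<union> (\<Union>w\<in>Gam m. {u. adj w u}))"
    using Suc.IH finite_adj Gam_Vert by auto
  ultimately show ?case by (rule finite_subset)
qed

text \<open>Topplings commute: the state depends on the sequence only through its counts.\<close>

lemma run_topplings_eq:
  assumes "u \<in> S" "S \<subseteq> Vert"
  shows "run_topplings S \<psi> vs u = \<psi> u - 7 * int (count_list vs u) + (\<Sum>w | adj u w. int (count_list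
      vs w))"
proof (induction vs arbitrary: \<psi>)
  case (Cons v vs)
  have fin: "finite {w. adj u w}" using assms finite_adj by blast
  have "(\<Sum>w | adj u w. int (count_list (v # vs) w)) = (\<Sum>w | adj u w. (if v
      = w then 1 else 0) + int (count_list vs w))"
    by (rule sum.cong) auto
  also have "\<dots> = (if adj u v then 1 else 0) + (\<Sum>w | adj u w. int (count_list vs w))"
    using fin by (simp add: sum.distrib)
  finally have s: "(\<Sum>w | adj u w. int (count_list (v # vs) w))
    = (if adj u v then 1 else 0) + (\<Sum>w | adj u w. int (count_list vs w))" .
  have "topple S v \<psi> u = \<psi> u - (if v = u then 7 else 0) + (if adj u v then 1 else 0)"
    using assms(1) adj_irrefl adj_sym by (auto simp: topple_def)
  thus ?case unfolding s by (simp add: Cons.IH)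
qed simp

text \<open>Least action principle: when \<open>x\<close> has toppled \<open>F x\<close> times and
  no vertex more often than \<open>F\<close> allows, its height is at most the one \<open>F\<close>
  would leave, which is below 7, so that another toppling at \<open>x\<close> is not legal.\<close>

lemma legal_count_le:
  fixes F :: "complex \<Rightarrow> int"
  assumes "legal_seq S \<psi> vs" "S \<subseteq> Vert" "\<And>u. F u \<ge> 0"
    and F: "\<And>u. u \<in> S \<Longrightarrow> \<psi> u - 7 * F u + (\<Sum>w | adj u w. F w) < 7"
  shows "int (count_list vs u) \<le> F u"
  using assms(1)
proof (induction vs arbitrary: u rule: rev_induct)
  case (snoc x vs)
  have leg: "legal_seq S \<psi> vs" and x: "x \<in> S" "run_topplings S \<psi> vs x \<ge> 7"
    using snoc.prems by (auto simp: legal_seq_append)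
  have IH: "int (count_list vs w) \<le> F w" for w using snoc.IH[OF leg] .
  have "int (count_list vs x) \<noteq> F x"
  proof
    assume eq: "int (count_list vs x) = F x"
    have "7 \<le> \<psi> x - 7 * F x + (\<Sum>w | adj x w. int (count_list vs w))"
      using x(2) unfolding run_topplings_eq[OF x(1) assms(2)] eq .
    also have "(\<Sum>w | adj x w. int (count_list vs w)) \<le> (\<Sum>w | adj x w. F w)"
      by (rule sum_mono) (rule IH)
    finally show False using F[OF x(1)] by simp
  qed
  thus ?case using IH[of u] IH[of x] by auto
qed (simp add: assms)

text \<open>A vertex of \<open>A\<close> that has not toppled but has a toppled neighbour holds at
  least 6 + 1 grains, so it may topple. By \<open>conn\<close> there is such a vertex until the wave
  fills \<open>A\<close>.\<close>

lemma ex_wave: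
  assumes A: "A \<subseteq> S" "finite A" and S: "S \<subseteq> Vert" and p: "p \<in> A" "\<psi> p \<ge> 7"
    and six: "\<And>v. v \<in> A \<Longrightarrow> \<psi> v \<ge> 6"
    and conn: "\<And>U. U \<subseteq> A \<Longrightarrow> p \<in> U \<Longrightarrow> U \<noteq> A \<Longrightarrow> \<exists>u\<in>U. \<exists>v\<in>A - U. adj u v"
  shows "\<exists>vs. legal_seq S \<psi> vs \<and> distinct vs \<and> set vs = A"
proof -
  have "\<exists>vs. legal_seq S \<psi> vs \<and> distinct vs \<and> set vs \<subseteq> A \<and> p \<in> set vs \<and> length vs = Suc n"
    if "Suc n \<le> card A" for n
    using that
  proof (induction n)
    case 0
    show ?case using A p by (intro exI[of _ "[p]"]) auto
  next
    case (Suc n)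
    then obtain vs where vs: "legal_seq S \<psi> vs" "distinct vs" "set vs \<subseteq> A" "p \<in> set vs"
        "length vs = Suc n"
      by auto
    have "set vs \<noteq> A" using vs Suc.prems distinct_card[OF vs(2)] by auto
    then obtain u v where uv: "u \<in> set vs" "v \<in> A - set vs" "adj u v" using conn vs by metis
    have vS: "v \<in> S" using uv A by auto
    have fin: "finite {w. adj v w}" using finite_adj vS S by blast
    have "1 \<le> int (count_list vs u)" using uv(1)
        by (simp add: Suc_le_eq count_list_0_iff flip: neq0_conv)
    also have "int (count_list vs u) \<le> (\<Sum>w | adj v w. int (count_list vs w))"
      by (rule member_le_sum) (use fin uv adj_sym in auto)
    finally have "run_topplings S \<psi> vs v \<ge> 7"
      unfolding run_topplings_eq[OF vS S] using six[of v] uv by (simp add: count_notin)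
    thus ?case using vs uv vS by (intro exI[of _ "vs @ [v]"]) (auto simp: legal_seq_append)
  qed
  moreover have "card A > 0" using A p by (auto simp: card_gt_0_iff)
  ultimately obtain vs where vs: "legal_seq S \<psi> vs" "distinct vs" "set vs \<subseteq> A" "length vs = card A"
    by (metis Suc_pred order_refl)
  hence "set vs = A" using A by (metis card_subset_eq distinct_card)
  thus ?thesis using vs by blast
qed

text \<open>In a set without \<open>o0\<close>, a vertex closest to \<open>o0\<close> has a still
  closer neighbour, which is outside the set. If \<open>U\<close> contains \<open>o0\<close>, this
  applies to the complement of \<open>U\<close> in the ball.\<close>

lemma Gam_connected:
  assumes U: "U \<subseteq> Gam j" "p \<in> U" "U \<noteq> Gam j"
  shows "\<exists>u\<in>U. \<exists>v\<in>Gam j - U. adj u v"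
proof -
  have exit: "\<exists>x\<in>X. \<exists>y\<in>Gam j - X. adj x y" if X: "X \<subseteq> Gam j" "X \<noteq> {}" "o0 \<notin> X" for X
  proof -
    obtain x where x: "x \<in> X" "\<And>y. y \<in> X \<Longrightarrow> L x \<le> L y"
      using ex_has_least_nat[of "\<lambda>x. x \<in> X" _ L] X(2) by blast
    obtain y where y: "adj x y" "L y < L x"
      using gdist_descent[of x] x X by (auto simp: Gamma_ball_def)
    have "y \<notin> X" using x(2) y(2) by (meson leD)
    moreover have "y \<in> Gam j" using y x X adj_Vert[OF y(1)] by (auto simp: Gamma_ball_def)
    ultimately show ?thesis using x y by blast
  qed
  show ?thesis
  proof (cases "o0 \<in> U")
    case True
    hence "\<exists>x\<in>Gam j - U. \<exists>y\<in>Gam j - (Gam j - U). adj x y" using U by (intro exit) auto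
    thus ?thesis using adj_sym U by blast
  next
    case False
    thus ?thesis using exit[of U] U by blast
  qed
qed

section \<open>Successive waves for a given set of extra grains\<close>

context
  fixes m :: nat and P :: "complex set"
  assumes P: "P \<noteq> {}" "P \<subseteq> Gam m"
begin

definition "lowest = Min (L ` P)"

text \<open>Counting from 1, wave \<open>k\<close> topples \<open>Gam (m + 1 - k)\<close> once, so
  \<open>u\<close> takes part in the first \<open>m + 1 - L u\<close> waves; this is the count after
  \<open>d\<close> waves. Outside \<open>Gam m\<close> truncated subtraction gives 0.\<close>

definition wave_count :: "nat \<Rightarrow> complex \<Rightarrow> nat" where
  "wave_count d u = min (m + 1 - L u) d"

lemma lowest: "\<exists>p\<in>P. L p = lowest" "p \<in> P \<Longrightarrow> lowest \<le> L p" "lowest \<le> m"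
proof -
  have fin: "finite P" using P(2) finite_Gam finite_subset by blast
  have "lowest \<in> L ` P" unfolding lowest_def using fin P by (intro Min_in) auto
  thus 1: "\<exists>p\<in>P. L p = lowest" by auto
  show "p \<in> P \<Longrightarrow> lowest \<le> L p" unfolding lowest_def using fin by (intro Min_le) auto
  show "lowest \<le> m" using 1 P(2) by (auto simp: Gamma_ball_def)
qed

lemma ex_waves:
  "d \<le> m + 1 - lowest \<Longrightarrow> \<exists>vs. legal_seq (Gam m) (phiP (Gam m) P) vs \<and> (\<forall>u\<in>Vert. count_list vs u
      = wave_count d u)"
proof (induction d)
  case 0
  show ?case by (intro exI[of _ "[]"]) (simp add: wave_count_def)
next
  case (Suc d)
  let ?S = "Gam m" and ?\<phi> = "phiP (Gam m) P"
  obtain ws where ws: "legal_seq ?S ?\<phi> ws" "\<And>u. u \<in> Vert \<Longrightarrow> count_list ws u = wave_count d u"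
    using Suc by auto
  let ?A = "Gam (m - d)"
  have AS: "?A \<subseteq> ?S" by (auto simp: Gamma_ball_def)
  obtain p where p: "p \<in> P" "L p = lowest" using lowest(1) by blast
  have pA: "p \<in> ?A" using p P(2) Suc.prems lowest(3) by (auto simp: Gamma_ball_def)
  \<comment> \<open>A vertex of \<open>?A\<close> and its seven neighbours have toppled exactly
    \<open>d\<close> times each, so its losses are made up and the extra grain at \<open>p\<close>
    can start the next wave.\<close>
  have run: "run_topplings ?S ?\<phi> ws v = ?\<phi> v" if v: "v \<in> ?A" for v
  proof -
    have vV: "v \<in> Vert" "L v \<le> m - d" using v by (auto simp: Gamma_ball_def)
    have d: "d \<le> m" using Suc.prems by simp
    have "int (count_list ws w) = int d" if "adj v w" for w
      using ws(2)[OF adj_Vert[OF that]] gdist_step[OF that] vV d by (simp add: wave_count_def)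
    hence "(\<Sum>w | adj v w. int (count_list ws w)) = (\<Sum>w | adj v w. int d)" by simp
    also have "\<dots> = 7 * int d" by (simp add: card_adj[OF vV(1)])
    finally show ?thesis
      using run_topplings_eq[of v ?S ?\<phi> ws] v AS Gam_Vert ws(2)[OF vV(1)] vV(2) d
          by (auto simp: wave_count_def)
  qed
  have "\<exists>vs. legal_seq ?S (run_topplings ?S ?\<phi> ws) vs \<and> distinct vs \<and> set vs = ?A"
  proof (rule ex_wave[OF AS finite_Gam Gam_Vert pA])
    show "run_topplings ?S ?\<phi> ws p \<ge> 7" using run[OF pA] p pA AS by (auto simp: phiP_def)
    show "run_topplings ?S ?\<phi> ws v \<ge> 6" if "v \<in> ?A" for v using run[OF that] that AS
        by (auto simp: phiP_def)
  qed (rule Gam_connected)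
  then obtain vs where vs: "legal_seq ?S (run_topplings ?S ?\<phi> ws) vs" "distinct vs" "set vs = ?A"
      by blast
  have "count_list (ws @ vs) u = wave_count (Suc d) u" if u: "u \<in> Vert" for u
  proof -
    have "count_list vs u = (if u \<in> set vs then 1 else 0)"
      using vs(2) by (induction vs) auto
    hence "count_list vs u = (if L u \<le> m - d then 1 else 0)"
      using vs(3) u by (auto simp: Gamma_ball_def)
    thus ?thesis using ws(2)[OF u] Suc.prems by (simp add: wave_count_def)
  qed
  thus ?case using ws vs by (intro exI[of _ "ws @ vs"]) (auto simp: legal_seq_append)
qed

text \<open>Below \<open>lowest\<close> the count is the same at \<open>u\<close> and its
  neighbours, and \<open>u\<close> is not in \<open>P\<close>. At \<open>lowest\<close> no neighbour
  has a larger count and one has a smaller one. Above, the counts are \<open>m + 1 - L\<close>, also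
  at neighbours at distance \<open>m + 1\<close>, and subharmonicity of \<open>L\<close> gives a net
  loss.\<close>

lemma wave_count_stable:
  assumes u: "u \<in> Gam m"
  shows "phiP (Gam m) P u - 7 * int (wave_count (m + 1 - lowest) u) + (\<Sum>w | adj u w. int
      (wave_count (m + 1 - lowest) w)) < 7"
proof -
  let ?F = "\<lambda>w. int (wave_count (m + 1 - lowest) w)"
  have uV: "u \<in> Vert" and um: "L u \<le> m" using u by (auto simp: Gamma_ball_def)
  note fin = finite_adj[OF uV]
  have eq: "(\<Sum>w | adj u w. ?F w) - 7 * ?F u = (\<Sum>w | adj u w. ?F w - ?F u)"
    by (simp add: sum_subtractf card_adj[OF uV])
  have near: "L w \<le> L u + 1" "L u \<le> L w + 1" if "adj u w" for w
    using gdist_step[OF that] gdist_step[OF adj_sym[OF that]] .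
  note sub = gdist_subharmonic[OF uV]
  consider "L u < lowest" | "L u = lowest" | "L u > lowest" by linarith
  hence "(\<Sum>w | adj u w. ?F w - ?F u) \<le> (if u \<in> P then - 1 else 0)"
  proof cases
    case 1
    have "?F w - ?F u = 0" if "adj u w" for w using near[OF that] 1 lowest(3)
        by (simp add: wave_count_def)
    hence "(\<Sum>w | adj u w. ?F w - ?F u) = 0" by simp
    moreover have "u \<notin> P" using lowest(2) 1 by (meson leD)
    ultimately show ?thesis by simp
  next
    case 2
    have "\<exists>w. adj u w \<and> L w > L u"
    proof (rule ccontr)
      assume "\<not> ?thesis"
      hence "(\<Sum>w | adj u w. int (L w) - int (L u)) \<le> 0" by (intro sum_nonpos) (auto simp: not_less)
      thus False using sub by simp
    qed
    then obtain w where w: "adj u w" "L w > L u" by blast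
    have "(\<Sum>w | adj u w. ?F w - ?F u) < (\<Sum>w | adj u w. 0)"
    proof (rule sum_strict_mono_ex1[OF fin])
      show "\<forall>x\<in>{w. adj u w}. ?F x - ?F u \<le> 0" using 2 lowest(3) by (auto simp: wave_count_def)
      show "\<exists>a\<in>{w. adj u w}. ?F a - ?F u < 0" using w 2 lowest(3)
          by (intro bexI[of _ w]) (auto simp: wave_count_def)
    qed
    thus ?thesis by simp
  next
    case 3
    have "?F w - ?F u = - (int (L w) - int (L u))" if "adj u w" for w
      using near[OF that] 3 um by (simp add: wave_count_def)
    hence "(\<Sum>w | adj u w. ?F w - ?F u) = (\<Sum>w | adj u w. - (int (L w) - int (L u)))"
      by (intro sum.cong) auto
    also have "\<dots> = - (\<Sum>w | adj u w. int (L w) - int (L u))" by (rule sum_negf)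
    finally show ?thesis using sub by simp
  qed
  thus ?thesis using eq u by (simp add: phiP_def split: if_splits)
qed

text \<open>Least action both ways: the wave counts stabilise and so bound the chosen relaxation,
  whose own counts stabilise and so bound the legal sequence of waves.\<close>

lemma toppling_fun_eq:
  assumes v: "v \<in> Gam m"
  shows "toppling_fun (Gam m) (phiP (Gam m) P) v = min (m + 1 - L v) (m + 1 - lowest)"
proof -
  let ?S = "Gam m" and ?\<phi> = "phiP (Gam m) P" and ?F = "wave_count (m + 1 - lowest)"
  obtain ws where ws: "legal_seq ?S ?\<phi> ws" "\<And>u. u \<in> Vert \<Longrightarrow> count_list ws u = ?F u"
    using ex_waves[of "m + 1 - lowest"] by auto
  have "stable ?S (run_topplings ?S ?\<phi> ws)"
    unfolding stable_def
  proof
    fix u assume u: "u \<in> ?S"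
    hence uV: "u \<in> Vert" using Gam_Vert by blast
    have "(\<Sum>w | adj u w. int (count_list ws w)) = (\<Sum>w | adj u w. int (?F w))"
      using ws(2) adj_Vert by (intro sum.cong) auto
    thus "run_topplings ?S ?\<phi> ws u < 7"
      using wave_count_stable[OF u] run_topplings_eq[OF u Gam_Vert, of ?\<phi> ws] ws(2)[OF uV] by simp
  qed
  hence "is_relaxation ?S ?\<phi> ws" using ws(1) by (simp add: is_relaxation_def)
  define xs where "xs = (SOME vs. is_relaxation ?S ?\<phi> vs)"
  have xs: "legal_seq ?S ?\<phi> xs" "stable ?S (run_topplings ?S ?\<phi> xs)"
    using someI[of "is_relaxation ?S ?\<phi>", OF \<open>is_relaxation ?S ?\<phi> ws\<close>]
    unfolding xs_def[symmetric] by (simp_all add: is_relaxation_def)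
  have "int (count_list xs v) \<le> int (?F v)"
    by (rule legal_count_le[OF xs(1) Gam_Vert]) (use wave_count_stable in auto)
  moreover have "int (count_list ws v) \<le> int (count_list xs v)"
    by (rule legal_count_le[OF ws(1) Gam_Vert])
      (use xs(2) in \<open>auto simp: stable_def run_topplings_eq[OF _ Gam_Vert]\<close>)
  ultimately have "count_list xs v = ?F v" using ws(2)[of v] subsetD[OF Gam_Vert v] by auto
  thus ?thesis by (simp add: toppling_fun_def xs_def wave_count_def)
qed

end

end

section \<open>Transfer to the tiling and conclusion\<close>

lemma layered_graph_tiling:
  assumes o0: "o0 \<in> Vert"
  shows "layered_graph o0"
proof
  show "o0 \<in> Vert" by (rule o0)
  show "u \<in> Vert" if "adj v u" for v u using adj_imp_Vert[OF that] by blast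
  show "adj u v" if "adj v u" for v u by (rule adj_commute[OF that])
  show "\<not> adj v v" for v using adj_imp_adjv adjv_irrefl by blast
  show "card {u. adj v u} = 7" if "v \<in> Vert" for v
    using bij_betw_same_card[OF bij_hyp_neighbours[OF that]] card_neighbours[OF Vert_hyp[OF that]]
        by simp
  show "gdist o0 u \<le> gdist o0 v + 1" if "adj v u" for v u
    using sep_count_step[OF adj_imp_adjv[OF that] Vert_hyp[OF o0]] adj_imp_Vert[OF that]
        by (simp add: sep_count_eq_gdist[OF o0])
  show "\<exists>u. adj v u \<and> gdist o0 u < gdist o0 v" if v: "v \<in> Vert" "v \<noteq> o0" for v
  proof -
    obtain u where u: "adj v u" "sep_count (hyp o0) (hyp v) = sep_count (hyp o0) (hyp u) + 2"
      using ex_descent[OF o0 v] by blast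
    thus ?thesis using adj_imp_Vert[OF u(1)] by (intro exI[of _ u]) (simp add:
        sep_count_eq_gdist[OF o0])
  qed
  show "1 \<le> (\<Sum>u | adj v u. int (gdist o0 u) - int (gdist o0 v))" if v: "v \<in> Vert" for v
  proof -
    have "2 \<le> (\<Sum>y | adjv (hyp v) y. int (sep_count (hyp o0) y) - int (sep_count (hyp o0) (hyp v)))"
      by (rule sep_count_subharmonic[OF Vert_hyp[OF v] Vert_hyp[OF o0]])
    also have "\<dots> = (\<Sum>u | adj v u. int (sep_count (hyp o0) (hyp u)) - int (sep_count (hyp o0) (hyp
        v)))"
      by (rule sum.reindex_bij_betw[OF bij_hyp_neighbours[OF v], symmetric])
    also have "\<dots> = (\<Sum>u | adj v u. 2 * (int (gdist o0 u) - int (gdist o0 v)))"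
      using adj_imp_Vert v by (intro sum.cong) (auto simp: sep_count_eq_gdist[OF o0])
    also have "\<dots> = 2 * (\<Sum>u | adj v u. int (gdist o0 u) - int (gdist o0 v))"
      by (rule sum_distrib_left[symmetric])
    finally show ?thesis by simp
  qed
qed

theorem theorem2p5:
  fixes o0 :: complex and m :: nat and P :: "complex set"
  assumes "o0 \<in> Vert"
    and "P \<noteq> {}" and "P \<subseteq> Gamma_ball o0 m"
  shows "\<forall>v \<in> Gamma_ball o0 m.
           toppling_fun (Gamma_ball o0 m) (phiP (Gamma_ball o0 m) P) v
             = min (m + 1 - gdist o0 v) (m + 1 - Min (gdist o0 ` P))"
proof -
  interpret layered_graph o0 by (rule layered_graph_tiling[OF assms(1)])
  show ?thesis using toppling_fun_eq[OF assms(2,3)] lowest_def[OF assms(2,3)] by simp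
qed

end
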